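(* For every acyclic 0/1-matrix $P$ there is a constant $C = C(P) > 0$ such that for every integer $n \geq 3$, $$\mathrm{Ex}(n,P) \leq n^{1 + \frac{C}{\log\log n}}.$$
   Context: Logarithms are base 2. Let $P$ be an $s \times t$ matrix with 0/1 entries. A copy of $P$ in a 0/1-matrix $M$ is an $s \times t$ submatrix $M'$ of $M$ (obtained by choosing $s$ rows and $t$ columns of $M$, keeping their order) such that $P$ can be obtained from $M'$ by turning some (possibly none) 1's into 0's. For an integer $n \geq 1$, $\mathrm{Ex}(n,P)$ denotes the maximum number of 1-entries in an $n \times n$ 0/1-matrix $M$ with no copy of $P$ (understood as $0$ if there is no such $M$). The matrix $P$ is called acyclic if the bipartite graph whose two parts are the rows and the columns of $P$, and whose edges correspond to the 1-entries of $P$, is a forest. *)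

theory Defs
  imports Complex_Main "Jordan_Normal_Form.DL_Submatrix"
begin

definition zero_one_mat :: "nat mat \<Rightarrow> bool" where
  "zero_one_mat M \<longleftrightarrow> elements_mat M \<subseteq> {0, 1}"

definition weight :: "nat mat \<Rightarrow> nat" where
  "weight M = card {(i, j). i < dim_row M \<and> j < dim_col M \<and> M $$ (i, j) = 1}"

text \<open>\<open>P\<close> arises from \<open>M\<close> by turning some (possibly none) 1-entries into 0.\<close>

definition deletes_to :: "nat mat \<Rightarrow> nat mat \<Rightarrow> bool" where
  "deletes_to M P \<longleftrightarrow> dim_row P = dim_row M \<and> dim_col P = dim_col M \<and>
     (\<forall>i < dim_row M. \<forall>j < dim_col M.
        P $$ (i, j) = M $$ (i, j) \<or> M $$ (i, j) = 1 \<and> P $$ (i, j) = 0)"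

text \<open>\<open>submatrix M I J\<close> enumerates \<open>I\<close> and \<open>J\<close> increasingly, so rows and columns keep
  their order; \<open>deletes_to\<close> forces \<open>card I\<close> and \<open>card J\<close> to be the dimensions of \<open>P\<close>.\<close>

definition contains_copy :: "nat mat \<Rightarrow> nat mat \<Rightarrow> bool" where
  "contains_copy M P \<longleftrightarrow>
     (\<exists>I J. I \<subseteq> {..<dim_row M} \<and> J \<subseteq> {..<dim_col M} \<and> deletes_to (submatrix M I J) P)"

text \<open>Weights are natural numbers, so inserting 0 only supplies the value 0 when no
  \<open>n \<times> n\<close> matrix avoids \<open>P\<close>.\<close>

definition Ex_mat :: "nat \<Rightarrow> nat mat \<Rightarrow> nat" where
  "Ex_mat n P =
     Max (insert 0 {weight M | M. M \<in> carrier_mat n n \<and> zero_one_mat M \<and> \<not> contains_copy M P})"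

text \<open>A simple graph is given by its set of edges, each a two-element set of vertices; isolated
  vertices play no role for cycles. A cycle is the list of its vertices in cyclic order.\<close>

definition graph_cycle :: "'v set set \<Rightarrow> 'v list \<Rightarrow> bool" where
  "graph_cycle E vs \<longleftrightarrow> 3 \<le> length vs \<and> distinct vs \<and>
     (\<forall>k < length vs. {vs ! k, vs ! (Suc k mod length vs)} \<in> E)"

definition graph_forest :: "'v set set \<Rightarrow> bool" where
  "graph_forest E \<longleftrightarrow> (\<nexists>vs. graph_cycle E vs)"

text \<open>\<open>Inl i\<close> is the vertex of row \<open>i\<close> and \<open>Inr j\<close> the vertex of column \<open>j\<close>.\<close>

definition bipartite_edges :: "nat mat \<Rightarrow> (nat + nat) set set" where
  "bipartite_edges P = {{Inl i, Inr j} | i j. i < dim_row P \<and> j < dim_col P \<and> P $$ (i, j) = 1}"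

definition acyclic_mat :: "nat mat \<Rightarrow> bool" where
  "acyclic_mat P \<longleftrightarrow> graph_forest (bipartite_edges P)"

lemma weight_le: "weight M \<le> dim_row M * dim_col M"
proof -
  have "weight M \<le> card ({..<dim_row M} \<times> {..<dim_col M})"
    unfolding weight_def by (rule card_mono) auto
  then show ?thesis by simp
qed

lemma finite_avoiding_weights:
  "finite {weight M | M. M \<in> carrier_mat n n \<and> zero_one_mat M \<and> \<not> contains_copy M P}"
proof (rule finite_subset)
  show "{weight M | M. M \<in> carrier_mat n n \<and> zero_one_mat M \<and> \<not> contains_copy M P} \<subseteq> {..n * n}"
  proof
    fix w
    assume "w \<in> {weight M | M. M \<in> carrier_mat n n \<and> zero_one_mat M \<and> \<not> contains_copy M P}"
    then obtain M where "w = weight M" "dim_row M = n" "dim_col M = n"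
      by auto
    then show "w \<in> {..n * n}"
      using weight_le[of M] by simp
  qed
qed simp

lemma Ex_mat_ge:
  assumes "M \<in> carrier_mat n n" "zero_one_mat M" "\<not> contains_copy M P"
  shows "weight M \<le> Ex_mat n P"
  unfolding Ex_mat_def using assms finite_avoiding_weights by (intro Max_ge) auto

lemma Ex_mat_le_iff:
  "Ex_mat n P \<le> b \<longleftrightarrow>
    (\<forall>M. M \<in> carrier_mat n n \<longrightarrow> zero_one_mat M \<longrightarrow> \<not> contains_copy M P \<longrightarrow> weight M \<le> b)"
  unfolding Ex_mat_def by (subst Max_le_iff) (auto simp: finite_avoiding_weights)

end

theory Submission
  imports Defs
begin

text \<open>Write \<open>n \<le> m ^ K\<close> with \<open>m\<close> a small power of \<open>log n\<close> and expand row and column indices in base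
  \<open>m\<close>. Fixing the row of a 1-entry and the first \<open>l\<close> digits of its column gives a decreasing chain
  of cells. A cell branches if at least \<open>\<tau>\<close> of its children carry a \<open>1 / m\<^sup>2\<close> fraction
  of it. If a matrix has more than \<open>const ^ K * n\<close> ones, most of them lie in branching row cells
  and branching column cells on a fraction of at least \<open>1 / log m\<close> of the levels.

  Colour a 1-entry by a \<open>\<tau>\<close>-set of heavy digits at which its row cell branches on level \<open>l\<close>, and
  by one for its column cell on level \<open>l'\<close>. For fixed \<open>l'\<close>, the density of a column colour in
  the row cells is a martingale in \<open>l\<close>, so on all but few of the \<open>K\<close> levels it is nearly the same
  in a cell and in its children. As \<open>K\<close> exceeds a large power of \<open>m\<close>, there are levels and
  colours \<open>S\<close>, \<open>S'\<close> for which these errors are negligible against the size of the colour class: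
  within the class almost every row cell meets all children in \<open>S\<close> and almost every column cell
  meets all children in \<open>S'\<close>. The forest is then embedded edge by edge, row \<open>i\<close> of the pattern into
  the \<open>i\<close>-th digit of \<open>S'\<close> and column \<open>j\<close> into the \<open>j\<close>-th digit of \<open>S\<close>, which takes care of the
  order.\<close>

section \<open>Cells and branching levels\<close>

text \<open>One abstract refinement serves rows and columns alike: \<open>key_Suc\<close> splits a
  cell by its next digit into at most \<open>m\<close> children, and \<open>inj_key\<close> makes
  the cells at level \<open>K\<close> singletons.\<close>

locale digit_filtration =
  fixes E :: "'e set" and key :: "nat \<Rightarrow> 'e \<Rightarrow> 'k" and dig :: "nat \<Rightarrow> 'e \<Rightarrow> nat"
    and m K \<tau> :: nat
  assumes finite_E [simp]: "finite E"
    and base_ge_2: "2 \<le> m"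
    and arity_pos: "0 < \<tau>"
    and dig_less: "\<And>l e. dig l e < m"
    and key_Suc: "\<And>l e e'. l < K \<Longrightarrow>
      key (Suc l) e = key (Suc l) e' \<longleftrightarrow> key l e = key l e' \<and> dig l e = dig l e'"
    and inj_key: "inj_on (key K) E"
begin

definition cell :: "nat \<Rightarrow> 'e \<Rightarrow> 'e set" where
  "cell l e = {x \<in> E. key l x = key l e}"

definition child :: "nat \<Rightarrow> 'e \<Rightarrow> nat \<Rightarrow> 'e set" where
  "child l e j = {x \<in> E. key l x = key l e \<and> dig l x = j}"

definition heavy :: "nat \<Rightarrow> 'e \<Rightarrow> nat set" where
  "heavy l e = {j. j < m \<and> card (cell l e) \<le> m\<^sup>2 * card (child l e j)}"

text \<open>The choice depends on \<open>heavy l e\<close> alone, so it is constant on cells and can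
  act as their colour.\<close>

definition branch :: "nat \<Rightarrow> 'e \<Rightarrow> nat set option" where
  "branch l e = (if \<tau> \<le> card (heavy l e)
     then Some (SOME S. S \<subseteq> heavy l e \<and> card S = \<tau>) else None)"

text \<open>The conditional expectation of the indicator of \<open>F\<close> given the cell at level
  \<open>l\<close>, for the uniform measure on \<open>E\<close>; a martingale in
  \<open>l\<close>.\<close>

definition dens :: "'e set \<Rightarrow> nat \<Rightarrow> 'e \<Rightarrow> real" where
  "dens F l e = real (card (F \<inter> cell l e)) / real (card (cell l e))"

text \<open>Only a loss of density in a heavy child is harmful: the embedding moves to heavy
  children only, and their size makes such a loss visible in the martingale increments.\<close>

definition skew :: "'e set \<Rightarrow> nat \<Rightarrow> 'e \<Rightarrow> bool" where
  "skew F l e \<longleftrightarrow>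
     (\<exists>x \<in> cell l e. dig l x \<in> heavy l e \<and> dens F (Suc l) x < dens F l e / 2)"

lemma finite_cell [simp]: "finite (cell l e)" and finite_child [simp]: "finite (child l e j)"
  by (simp_all add: cell_def child_def)

lemma finite_heavy [simp]: "finite (heavy l e)"
  by (simp add: heavy_def)

lemma cell_subset: "cell l e \<subseteq> E"
  by (auto simp: cell_def)

lemma self_in_cell: "e \<in> E \<Longrightarrow> e \<in> cell l e"
  by (simp add: cell_def)

lemma card_cell_pos: "e \<in> E \<Longrightarrow> 0 < card (cell l e)"
  using self_in_cell[of e l] by (auto simp: card_gt_0_iff)

lemma child_subset_cell: "child l e j \<subseteq> cell l e"
  by (auto simp: child_def cell_def)

lemma key_eq_cell:
  assumes "key l x = key l e"
  shows "cell l x = cell l e" "child l x = child l e" "heavy l x = heavy l e"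
    "branch l x = branch l e" "dens F l x = dens F l e" "skew F l x = skew F l e"
proof -
  show c: "cell l x = cell l e" and d: "child l x = child l e"
    using assms by (auto simp: cell_def child_def fun_eq_iff)
  show h: "heavy l x = heavy l e"
    by (simp add: heavy_def c d)
  show "branch l x = branch l e" "dens F l x = dens F l e"
    by (simp_all add: branch_def dens_def h c)
  then show "skew F l x = skew F l e"
    by (simp add: skew_def h c)
qed

lemma cell_keyD: "x \<in> cell l e \<Longrightarrow> key l x = key l e"
  by (simp add: cell_def)

lemma branch_SomeD:
  assumes "branch l e = Some S"
  shows "S \<subseteq> heavy l e" "card S = \<tau>"
proof -
  let ?P = "\<lambda>S. S \<subseteq> heavy l e \<and> card S = \<tau>"
  have "\<tau> \<le> card (heavy l e)" and S: "S = (SOME S. ?P S)"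
    using assms by (auto simp: branch_def split: if_splits)
  then have "\<exists>S. ?P S"
    by (meson obtain_subset_with_card_n)
  then have "?P S"
    unfolding S by (rule someI_ex)
  then show "S \<subseteq> heavy l e" "card S = \<tau>" by simp_all
qed

lemma heavy_less: "heavy l e \<subseteq> {..<m}"
  by (auto simp: heavy_def)

section \<open>Sums over cells, and entries with few branching levels\<close>

lemma sum_by_cells: "sum g E = (\<Sum>k \<in> key l ` E. sum g {x \<in> E. key l x = k})"
  by (rule sum.image_gen) simp

lemma sum_cells_mono:
  fixes g h :: "'e \<Rightarrow> real"
  assumes "\<And>e. e \<in> E \<Longrightarrow> sum g (cell l e) \<le> sum h (cell l e)"
  shows "sum g E \<le> sum h E"
  unfolding sum_by_cells[of _ l] by (rule sum_mono) (use assms in \<open>auto simp: cell_def\<close>)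

lemma card_cells_mono:
  fixes c :: real
  assumes "A \<subseteq> E" "B \<subseteq> E"
    and "\<And>e. e \<in> E \<Longrightarrow> real (card (A \<inter> cell l e)) \<le> c * real (card (B \<inter> cell l e))"
  shows "real (card A) \<le> c * real (card B)"
proof -
  have card_ind: "real (card (X \<inter> Y)) = (\<Sum>x \<in> Y. of_bool (x \<in> X))" if "finite Y" for X Y :: "'e set"
    using that by (simp add: Int_commute)
  have "(\<Sum>x \<in> E. of_bool (x \<in> A) :: real) \<le> (\<Sum>x \<in> E. c * of_bool (x \<in> B))"
    using assms(3) by (intro sum_cells_mono[of _ l]) (simp add: card_ind sum_distrib_left del: sum_of_bool_eq sum_of_bool_mult_eq sum_mult_of_bool_eq)
  then have "real (card (A \<inter> E)) \<le> c * real (card (B \<inter> E))"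
    by (simp add: card_ind sum_distrib_left del: sum_of_bool_eq sum_of_bool_mult_eq sum_mult_of_bool_eq)
  then show ?thesis using assms(1,2) by (simp add: Int_absorb2)
qed

lemma sum_cell_by_children: "sum g (cell l e) = (\<Sum>j<m. sum g (child l e j))"
proof -
  have "(\<Sum>j<m. sum g {x \<in> cell l e. dig l x = j}) = sum g (cell l e)"
    by (rule sum.group) (auto simp: dig_less)
  moreover have "{x \<in> cell l e. dig l x = j} = child l e j" for j
    by (auto simp: cell_def child_def)
  ultimately show ?thesis by simp
qed

text \<open>The weight \<open>(1 / m) ^ (number of branching levels)\<close> makes the induction close: a branching
  level pays for its at most \<open>m\<close> children, and at any other level the square root makes the
  light children contribute at most one full unit together.\<close>

lemma sum_branching_weight:
  assumes "l \<le> K" "e \<in> E"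
  shows "(\<Sum>x \<in> cell l e. (1 / real m) ^ card {i. l \<le> i \<and> i < K \<and> branch i x \<noteq> None})
    \<le> real \<tau> ^ (K - l) * sqrt (card (cell l e))"
  using assms
proof (induction arbitrary: e rule: inc_induct)
  case base
  have c: "cell K e = {e}"
    using inj_key base by (auto simp: cell_def inj_on_def)
  have s: "{i. K \<le> i \<and> i < K \<and> branch i x \<noteq> None} = {}" for x by auto
  show ?case unfolding c s by simp
next
  case (step l)
  define g where "g l x = (1 / real m) ^ card {i. l \<le> i \<and> i < K \<and> branch i x \<noteq> None}" for l x
  define w :: real where "w = (if branch l e = None then 1 else 1 / real m)"
  define T where "T = real \<tau> ^ (K - Suc l)"
  have m: "real m \<ge> 2" using base_ge_2 by simp
  have T: "T \<ge> 1" using arity_pos by (simp add: T_def)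
  have w: "w \<ge> 0" by (simp add: w_def)
  have g_Suc: "g l x = w * g (Suc l) x" if "x \<in> cell l e" for x
  proof -
    have b: "branch l x = branch l e" using that by (intro key_eq_cell cell_keyD)
    have "{i. l \<le> i \<and> i < K \<and> branch i x \<noteq> None} =
        (if branch l x = None then {} else {l}) \<union> {i. Suc l \<le> i \<and> i < K \<and> branch i x \<noteq> None}"
      using step.hyps by (auto simp: le_less_Suc_eq Suc_le_eq order_le_less)
    then show ?thesis
      by (simp add: g_def w_def b)
  qed
  have child_le: "sum (g (Suc l)) (child l e j) \<le> T * sqrt (card (child l e j))" for j
  proof (cases "child l e j = {}")
    case False
    then obtain x where x: "x \<in> child l e j" by auto
    then have "child l e j = cell (Suc l) x" "x \<in> E"
      using step.hyps by (auto simp: child_def cell_def key_Suc)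
    then show ?thesis using step.IH[of x] by (simp add: g_def T_def)
  qed simp
  have "sum (g l) (cell l e) = w * sum (g (Suc l)) (cell l e)"
    by (simp add: sum_distrib_left g_Suc)
  also have "\<dots> = w * (\<Sum>j<m. sum (g (Suc l)) (child l e j))"
    by (simp add: sum_cell_by_children)
  also have "\<dots> \<le> w * (\<Sum>j<m. T * sqrt (card (child l e j)))"
    using w by (intro mult_left_mono sum_mono child_le)
  also have "\<dots> = T * (w * (\<Sum>j<m. sqrt (card (child l e j))))"
    by (simp add: sum_distrib_left mult_ac)
  also have "\<dots> \<le> T * (real \<tau> * sqrt (card (cell l e)))"
  proof (rule mult_left_mono)
    have child_le_cell: "sqrt (card (child l e j)) \<le> sqrt (card (cell l e))" for j
      by (simp add: card_mono child_subset_cell)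
    show "w * (\<Sum>j<m. sqrt (card (child l e j))) \<le> real \<tau> * sqrt (card (cell l e))"
    proof (cases "branch l e = None")
      case True
      then have h: "card (heavy l e) < \<tau>"
        by (simp add: branch_def split: if_splits)
      have light: "sqrt (card (child l e j)) \<le> sqrt (card (cell l e)) / real m"
        if "j < m" "j \<notin> heavy l e" for j
      proof -
        have "m\<^sup>2 * card (child l e j) \<le> card (cell l e)"
          using that by (simp add: heavy_def)
        then have "real (m\<^sup>2 * card (child l e j)) \<le> real (card (cell l e))"
          by (rule of_nat_mono)
        then have "sqrt ((real m)\<^sup>2 * card (child l e j)) \<le> sqrt (card (cell l e))"
          by simp
        then show ?thesis
          using m by (simp add: real_sqrt_mult field_simps)
      qed
      have "(\<Sum>j<m. sqrt (card (child l e j)))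
          \<le> (\<Sum>j<m. (of_bool (j \<in> heavy l e) + 1 / real m) * sqrt (card (cell l e)))"
      proof (rule sum_mono)
        fix j assume "j \<in> {..<m}"
        then show "sqrt (card (child l e j))
            \<le> (of_bool (j \<in> heavy l e) + 1 / real m) * sqrt (card (cell l e))"
          using light[of j] child_le_cell[of j]
          by (cases "j \<in> heavy l e") (auto simp: distrib_right intro: add_increasing2)
      qed
      also have "\<dots> = (card (heavy l e) + 1) * sqrt (card (cell l e))"
        using m heavy_less[of l e]
        by (simp flip: sum_distrib_right add: sum.distrib Int_absorb2 Int_absorb1)
      \<comment> \<open>Fewer than \<open>\<tau>\<close> heavy children count one unit each, and the
        light ones one unit together.\<close>
      also have "\<dots> \<le> real \<tau> * sqrt (card (cell l e))"
        using h by (intro mult_right_mono) auto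
      finally show ?thesis using True by (simp add: w_def)
    next
      case False
      then have w: "w = 1 / real m" by (cases "branch l e") (simp_all add: w_def)
      have "(\<Sum>j<m. sqrt (card (child l e j))) \<le> (\<Sum>j<m. sqrt (card (cell l e)))"
        by (intro sum_mono child_le_cell)
      then have "w * (\<Sum>j<m. sqrt (card (child l e j))) \<le> sqrt (card (cell l e))"
        unfolding w using m by (simp add: field_simps)
      also have "\<dots> \<le> real \<tau> * sqrt (card (cell l e))"
        using arity_pos by (simp add: mult_le_cancel_right1)
      finally show ?thesis .
    qed
  qed (use T in simp)
  also have "\<dots> = real \<tau> ^ (K - l) * sqrt (card (cell l e))"
    using step.hyps(2) by (simp add: T_def Suc_diff_Suc[OF step.hyps(2), symmetric])
  finally show ?case by (simp add: g_def)
qed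

text \<open>Markov's inequality for the weight in \<open>sum_branching_weight\<close>: an entry with
  fewer than \<open>N\<close> branching levels has weight at least \<open>(1 / m) ^ N\<close>, and
  \<open>m ^ N \<le> 2 ^ K\<close>.\<close>

lemma few_unbranched:
  assumes "m ^ N \<le> 2 ^ K"
  shows "real (card {e \<in> E. card {i. i < K \<and> branch i e \<noteq> None} < N})
    \<le> real (card E) / 8 + 2 * real (card (key 0 ` E)) * (2 * real \<tau>) ^ (2 * K)"
proof -
  define c where "c e = card {i. i < K \<and> branch i e \<noteq> None}" for e
  define L where "L = (2 * real \<tau>) ^ K"
  have m: "real m \<ge> 2" using base_ge_2 by simp
  have cell_bound: "(\<Sum>x \<in> cell 0 e. of_bool (c x < N)) \<le> real (card (cell 0 e)) / 8 + 2 * L\<^sup>2"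
    if "e \<in> E" for e
  proof -
    define q where "q = sqrt (card (cell 0 e))"
    have "(\<Sum>x \<in> cell 0 e. of_bool (c x < N)) \<le> (\<Sum>x \<in> cell 0 e. real m ^ N * (1 / real m) ^ c x)"
    proof (rule sum_mono)
      fix x
      have "1 \<le> real m ^ (N - c x)" using m by (intro one_le_power) simp
      then show "of_bool (c x < N) \<le> real m ^ N * (1 / real m) ^ c x"
        using m by (auto simp: power_diff power_one_over field_simps)
    qed
    also have "\<dots> \<le> real m ^ N * (real \<tau> ^ K * q)"
      unfolding sum_distrib_left[symmetric] c_def q_def
      using sum_branching_weight[of 0 e] that by (intro mult_left_mono) simp_all
    also have "\<dots> \<le> 2 ^ K * (real \<tau> ^ K * q)"
    proof (rule mult_right_mono)
      show "real m ^ N \<le> 2 ^ K"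
        using assms by (metis of_nat_mono of_nat_numeral of_nat_power)
    qed (simp add: q_def)
    also have "\<dots> = L * q" by (simp add: L_def power_mult_distrib)
    \<comment> \<open>This trades the square root for a small multiple of the cell size plus an
      error per root cell. One eighth is small enough to pay for both directions in
      \<open>reach_nonempty\<close>.\<close>
    also have "\<dots> \<le> q\<^sup>2 / 8 + 2 * L\<^sup>2"
    proof -
      have "0 \<le> (q - 4 * L)\<^sup>2" by simp
      then show ?thesis by (simp add: power2_eq_square algebra_simps)
    qed
    also have "q\<^sup>2 = card (cell 0 e)" by (simp add: q_def)
    finally show ?thesis .
  qed
  have "(\<Sum>x \<in> E. of_bool (c x < N)) \<le> (\<Sum>k \<in> key 0 ` E. real (card {x \<in> E. key 0 x = k}) / 8 + 2 * L\<^sup>2)"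
    unfolding sum_by_cells[of _ 0] using cell_bound by (intro sum_mono) (auto simp: cell_def)
  also have "\<dots> = real (card E) / 8 + 2 * real (card (key 0 ` E)) * L\<^sup>2"
    using sum_by_cells[of "\<lambda>_. 1 :: real" 0, unfolded sum_constant, symmetric]
    by (simp only: sum.distrib sum_divide_distrib[symmetric]) simp
  also have "L\<^sup>2 = (2 * real \<tau>) ^ (2 * K)" by (simp add: L_def power_even_eq)
  also have "(\<Sum>x \<in> E. of_bool (c x < N)) = real (card {x \<in> E. c x < N})"
    using finite_E by (subst sum_of_bool_eq) (simp_all add: Collect_conj_eq)
  finally show ?thesis by (simp only: c_def)
qed

section \<open>Cell densities as a martingale\<close>

lemma dens_nonneg: "0 \<le> dens F l e"
  by (simp add: dens_def)

lemma dens_le_1: "dens F l e \<le> 1"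
  by (simp add: dens_def divide_le_eq_1 card_mono card_gt_0_iff)

lemma dens_mult_card: "e \<in> E \<Longrightarrow> dens F l e * card (cell l e) = card (F \<inter> cell l e)"
  using card_cell_pos[of e l] by (simp add: dens_def)

text \<open>The tower property: averaging the indicator of \<open>F\<close> over cells does not
  change its sum against a function that is constant on cells.\<close>

lemma sum_dens_mult:
  assumes "F \<subseteq> E" "\<And>x y. x \<in> E \<Longrightarrow> y \<in> E \<Longrightarrow> key l x = key l y \<Longrightarrow> g x = g y"
  shows "(\<Sum>e \<in> E. dens F l e * g e) = sum g F"
proof -
  have cell_eq: "(\<Sum>x \<in> cell l e. dens F l x * g x) = (\<Sum>x \<in> cell l e. of_bool (x \<in> F) * g x)"
    if e: "e \<in> E" for e
  proof -
    have g: "g x = g e" "dens F l x = dens F l e" if "x \<in> cell l e" for x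
      using that e assms(2)[of x e] by (auto simp: cell_def intro: key_eq_cell)
    have "(\<Sum>x \<in> cell l e. dens F l x * g x) = dens F l e * card (cell l e) * g e"
      by (simp add: g)
    also have "\<dots> = (\<Sum>x \<in> cell l e. of_bool (x \<in> F) * g e)"
      using dens_mult_card[OF e] by (simp add: Int_commute flip: sum_distrib_right)
    finally show ?thesis by (simp add: g)
  qed
  have "(\<Sum>e \<in> E. dens F l e * g e) = (\<Sum>e \<in> E. of_bool (e \<in> F) * g e)"
    unfolding sum_by_cells[of _ l] by (rule sum.cong) (use cell_eq in \<open>auto simp: cell_def\<close>)
  also have "\<dots> = sum g F"
    using assms(1) by (simp add: Int_absorb1)
  finally show ?thesis .
qed

text \<open>Orthogonality of martingale increments: by \<open>sum_dens_mult\<close> the cross term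
  and the sum of squares at level \<open>l\<close> both equal the sum of \<open>dens F l\<close>
  over \<open>F\<close>.\<close>

lemma sum_dens_increment:
  assumes "F \<subseteq> E" "l < K"
  shows "(\<Sum>e \<in> E. (dens F (Suc l) e - dens F l e)\<^sup>2)
    = (\<Sum>e \<in> E. (dens F (Suc l) e)\<^sup>2) - (\<Sum>e \<in> E. (dens F l e)\<^sup>2)"
proof -
  have "(\<Sum>e \<in> E. dens F (Suc l) e * dens F l e) = sum (dens F l) F"
    by (rule sum_dens_mult[OF assms(1)]) (use assms(2) key_Suc key_eq_cell(5) in blast)
  moreover have "(\<Sum>e \<in> E. dens F l e * dens F l e) = sum (dens F l) F"
    by (rule sum_dens_mult[OF assms(1)]) (use key_eq_cell(5) in blast)
  moreover have "(dens F (Suc l) e - dens F l e)\<^sup>2 =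
      (dens F (Suc l) e)\<^sup>2 + (dens F l e)\<^sup>2 - 2 * (dens F (Suc l) e * dens F l e)" for e
    by (simp add: power2_diff)
  ultimately show ?thesis
    by (simp add: sum.distrib sum_subtractf flip: sum_distrib_left) (simp add: power2_eq_square)
qed

text \<open>The squares telescope and densities are at most 1. The bound is independent of
  \<open>K\<close>, so on an average level the increments are small.\<close>

lemma sum_dens_increments_le:
  assumes "F \<subseteq> E"
  shows "(\<Sum>l<K. \<Sum>e \<in> E. (dens F (Suc l) e - dens F l e)\<^sup>2) \<le> card E"
proof -
  have "(\<Sum>l<K. \<Sum>e \<in> E. (dens F (Suc l) e - dens F l e)\<^sup>2)
      = (\<Sum>e \<in> E. (dens F K e)\<^sup>2) - (\<Sum>e \<in> E. (dens F 0 e)\<^sup>2)"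
    using sum_lessThan_telescope[of "\<lambda>l. \<Sum>e \<in> E. (dens F l e)\<^sup>2" K]
    by (simp add: sum_dens_increment[OF assms])
  also have "\<dots> \<le> (\<Sum>e \<in> E. (dens F K e)\<^sup>2)" by (simp add: sum_nonneg)
  also have "\<dots> \<le> (\<Sum>e \<in> E. 1)"
    by (intro sum_mono) (simp add: dens_nonneg dens_le_1 power_le_one)
  finally show ?thesis by simp
qed

text \<open>The heavy child that loses density fills at least a \<open>1 / m^2\<close> part of the
  cell, and on it the increment is at least half the density; squaring that half gives the factor
  4.\<close>

lemma skew_cell_increment:
  assumes "l < K" "e \<in> E" "skew F l e"
  shows "real (card (cell l e)) * (dens F l e)\<^sup>2
    \<le> 4 * (real m)\<^sup>2 * (\<Sum>x \<in> cell l e. (dens F (Suc l) x - dens F l x)\<^sup>2)"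
proof -
  from assms(3) obtain y where y: "y \<in> cell l e" "dig l y \<in> heavy l e"
    "dens F (Suc l) y < dens F l e / 2" by (auto simp: skew_def)
  define C where "C = child l e (dig l y)"
  have "real (card (cell l e)) \<le> (real m)\<^sup>2 * card C"
    using y(2) unfolding heavy_def C_def by (metis (mono_tags) mem_Collect_eq of_nat_mono of_nat_mult of_nat_power)
  then have "real (card (cell l e)) * (dens F l e)\<^sup>2 \<le> (real m)\<^sup>2 * card C * (dens F l e)\<^sup>2"
    by (intro mult_right_mono) auto
  also have "\<dots> = 4 * (real m)\<^sup>2 * (\<Sum>x \<in> C. (dens F l e / 2)\<^sup>2)"
    by (simp add: power_divide)
  also have "\<dots> \<le> 4 * (real m)\<^sup>2 * (\<Sum>x \<in> C. (dens F (Suc l) x - dens F l x)\<^sup>2)"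
  proof (intro mult_left_mono sum_mono)
    fix x assume "x \<in> C"
    then have x: "key l x = key l e" "key (Suc l) x = key (Suc l) y"
      using assms(1) y(1) by (auto simp: C_def child_def cell_def key_Suc)
    have "dens F l e / 2 \<le> dens F l x - dens F (Suc l) x"
      using y(3) key_eq_cell(5)[OF x(1), of F] key_eq_cell(5)[OF x(2), of F] by simp
    then have "(dens F l e / 2)\<^sup>2 \<le> (dens F l x - dens F (Suc l) x)\<^sup>2"
      using dens_nonneg[of F l e] by (intro power_mono) auto
    then show "(dens F l e / 2)\<^sup>2 \<le> (dens F (Suc l) x - dens F l x)\<^sup>2"
      by (simp add: power2_commute)
  qed auto
  also have "\<dots> \<le> 4 * (real m)\<^sup>2 * (\<Sum>x \<in> cell l e. (dens F (Suc l) x - dens F l x)\<^sup>2)"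
    by (intro mult_left_mono sum_mono2) (auto simp: C_def child_def cell_def)
  finally show ?thesis .
qed

text \<open>A cell counts here in proportion to its density \<open>d\<close>. If
  \<open>d \<le> \<theta>\<close> it contributes to the first term; otherwise
  \<open>d \<le> d^2 / \<theta>\<close>, and \<open>skew_cell_increment\<close> applies.\<close>

lemma card_skew_le:
  fixes \<theta> :: real
  assumes "F \<subseteq> E" "l < K" "0 < \<theta>"
  shows "real (card {e \<in> F. skew F l e})
    \<le> \<theta> * card E + 4 * (real m)\<^sup>2 / \<theta> * (\<Sum>e \<in> E. (dens F (Suc l) e - dens F l e)\<^sup>2)"
proof -
  have split: "d \<le> \<theta> + d\<^sup>2 / \<theta>" if "d \<ge> 0" for d :: real
  proof (cases "d \<le> \<theta>")
    case True
    then show ?thesis using assms(3) by (simp add: add_increasing2)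
  next
    case False
    then have "\<theta> * d \<le> d * d" using that by (intro mult_right_mono) auto
    then have "d \<le> d\<^sup>2 / \<theta>" using assms(3) by (simp add: field_simps power2_eq_square)
    then show ?thesis using assms(3) by simp
  qed
  have "real (card {e \<in> F. skew F l e}) = (\<Sum>e \<in> F. of_bool (skew F l e))"
    using assms(1) by (simp add: finite_subset[OF assms(1)] Int_def)
  also have "\<dots> = (\<Sum>e \<in> E. dens F l e * of_bool (skew F l e))"
  proof (rule sum_dens_mult[symmetric, OF assms(1)])
    fix x y assume "key l x = key l y"
    then show "(of_bool (skew F l x) :: real) = of_bool (skew F l y)"
      using key_eq_cell(6)[of l x y F] by simp
  qed
  also have "\<dots> \<le> (\<Sum>e \<in> E. \<theta> + of_bool (skew F l e) * (dens F l e)\<^sup>2 / \<theta>)"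
    using split[OF dens_nonneg] assms(3) by (intro sum_mono) (auto simp: of_bool_def)
  also have "\<dots> = \<theta> * card E + (\<Sum>e \<in> E. of_bool (skew F l e) * (dens F l e)\<^sup>2) / \<theta>"
    by (simp only: sum.distrib sum_divide_distrib sum_constant) (simp only: mult.commute)
  also have "\<dots> \<le> \<theta> * card E + 4 * (real m)\<^sup>2 * (\<Sum>e \<in> E. (dens F (Suc l) e - dens F l e)\<^sup>2) / \<theta>"
  proof -
    have "(\<Sum>e \<in> E. of_bool (skew F l e) * (dens F l e)\<^sup>2)
      \<le> (\<Sum>e \<in> E. 4 * (real m)\<^sup>2 * (dens F (Suc l) e - dens F l e)\<^sup>2)"
  proof (rule sum_cells_mono[of _ l])
    fix e assume e: "e \<in> E"
    have "(\<Sum>x \<in> cell l e. of_bool (skew F l x) * (dens F l x)\<^sup>2)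
        = (\<Sum>x \<in> cell l e. of_bool (skew F l e) * (dens F l e)\<^sup>2)"
    proof (rule sum.cong)
      fix x assume "x \<in> cell l e"
      then show "of_bool (skew F l x) * (dens F l x)\<^sup>2 = of_bool (skew F l e) * (dens F l e)\<^sup>2"
        using key_eq_cell(5,6)[OF cell_keyD[of x l e]] by simp
    qed simp
    also have "\<dots> = of_bool (skew F l e) * (real (card (cell l e)) * (dens F l e)\<^sup>2)"
      by simp
    also have "\<dots> \<le> 4 * (real m)\<^sup>2 * (\<Sum>x \<in> cell l e. (dens F (Suc l) x - dens F l x)\<^sup>2)"
      using skew_cell_increment[OF assms(2) e, of F] by (cases "skew F l e") (auto simp: sum_nonneg)
    finally show "(\<Sum>x \<in> cell l e. of_bool (skew F l x) * (dens F l x)\<^sup>2)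
        \<le> (\<Sum>x \<in> cell l e. 4 * (real m)\<^sup>2 * (dens F (Suc l) x - dens F l x)\<^sup>2)"
      by (simp add: sum_distrib_left)
  qed
  then show ?thesis
    using assms(3) by (simp add: divide_right_mono sum_distrib_left)
  qed
  finally show ?thesis by simp
qed

lemma sum_card_skew_le:
  assumes "F \<subseteq> E" "0 < K"
  shows "(\<Sum>l<K. real (card {e \<in> F. skew F l e})) \<le> 4 * real m * sqrt K * card E"
proof -
  \<comment> \<open>Balances the two error terms: \<open>K * \<theta>\<close> and
    \<open>4 * m^2 / \<theta>\<close> both become \<open>2 * m * sqrt K\<close>.\<close>
  define \<theta> where "\<theta> = 2 * real m / sqrt K"
  define I where "I = (\<Sum>l<K. \<Sum>e \<in> E. (dens F (Suc l) e - dens F l e)\<^sup>2)"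
  have pos: "real m > 0" "sqrt K > 0" "\<theta> > 0" using base_ge_2 assms(2) by (auto simp: \<theta>_def)
  have "(\<Sum>l<K. real (card {e \<in> F. skew F l e}))
      \<le> (\<Sum>l<K. \<theta> * card E + 4 * (real m)\<^sup>2 / \<theta> * (\<Sum>e \<in> E. (dens F (Suc l) e - dens F l e)\<^sup>2))"
    using assms(1) pos(3) by (intro sum_mono card_skew_le) auto
  also have "\<dots> = real K * \<theta> * card E + 4 * (real m)\<^sup>2 / \<theta> * I"
    by (simp add: sum.distrib I_def sum_distrib_left)
  also have "\<dots> \<le> real K * \<theta> * card E + 4 * (real m)\<^sup>2 / \<theta> * card E"
    using sum_dens_increments_le[OF assms(1)] pos by (intro add_left_mono mult_left_mono) (auto simp: I_def)
  also have "real K * \<theta> = 2 * real m * sqrt K"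
    using pos(2) by (simp add: \<theta>_def field_simps)
  also have "4 * (real m)\<^sup>2 / \<theta> = 2 * real m * sqrt K"
    using pos by (simp add: \<theta>_def field_simps power2_eq_square)
  finally show ?thesis by (simp add: algebra_simps)
qed

text \<open>In a cell that is not skew, each child selected by \<open>S\<close> holds at least a
  \<open>1 / (2 * m^2)\<close> part of what \<open>G\<close> has in the cell. If the child misses
  \<open>X\<close>, all of that part lies in \<open>H - X\<close> and pays for the cell.\<close>

lemma card_lost_le:
  assumes "l < K" "G \<subseteq> E" and H: "H = {e \<in> G. branch l e = Some S}" and "X \<subseteq> H"
  shows "real (card {e \<in> H. \<exists>j \<in> S. X \<inter> child l e j = {}})
    \<le> real (card {e \<in> G. skew G l e}) + 2 * (real m)\<^sup>2 * real (card (H - X))"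
proof -
  define L where "L = {e \<in> H. \<not> skew G l e \<and> (\<exists>j \<in> S. X \<inter> child l e j = {})}"
  have fin: "finite G" using assms(2) by (rule finite_subset) simp
  have "real (card (L \<inter> cell l e)) \<le> 2 * (real m)\<^sup>2 * real (card ((H - X) \<inter> cell l e))" for e
  proof (cases "L \<inter> cell l e = {}")
    case False
    then obtain y where y: "y \<in> L" "y \<in> cell l e" by auto
    then have ke: "key l y = key l e" by (simp add: cell_def)
    from y(1) obtain j where j: "j \<in> S" "X \<inter> child l y j = {}"
      by (auto simp: L_def)
    have br: "branch l y = Some S" "\<not> skew G l y" using y(1) H by (auto simp: L_def)
    have hj: "j \<in> heavy l y" using j(1) branch_SomeD(1)[OF br(1)] by auto
    have yE: "y \<in> E" using y(2) cell_subset by auto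
    define c c' where "c = card (cell l y)" and "c' = card (child l y j)"
    have cle: "c \<le> m\<^sup>2 * c'" using hj by (simp add: heavy_def c_def c'_def)
    have cpos: "c > 0" using card_cell_pos[OF yE] by (simp add: c_def)
    then have "c' > 0" using cle by (cases c') auto
    then obtain x where x: "x \<in> child l y j" by (auto simp: c'_def card_gt_0_iff)
    have xc: "cell (Suc l) x = child l y j" "x \<in> cell l y" "dig l x = j"
      using x assms(1) by (auto simp: child_def cell_def key_Suc)
    have "dens G (Suc l) x \<ge> dens G l y / 2"
      using br(2) xc(2,3) hj by (auto simp: skew_def not_less)
    then have "real (card (G \<inter> cell l y)) / c / 2 \<le> real (card (G \<inter> child l y j)) / c'"
      by (simp add: dens_def xc(1) c_def c'_def)
    then have "real (card (G \<inter> cell l y)) * c' \<le> 2 * real (card (G \<inter> child l y j)) * c"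
      using cpos \<open>c' > 0\<close> by (simp add: field_simps)
    also have "\<dots> \<le> 2 * real (card (G \<inter> child l y j)) * (real m ^ 2 * c')"
      using of_nat_mono[OF cle, where ?'a = real] by (intro mult_left_mono) simp_all
    finally have dense: "real (card (G \<inter> cell l y)) \<le> 2 * (real m)\<^sup>2 * real (card (G \<inter> child l y j))"
      using \<open>c' > 0\<close> by (simp add: field_simps)
    \<comment> \<open>The colour at level \<open>l\<close> is shared by the whole cell, so the
      entries of \<open>G\<close> in the child belong to \<open>H\<close>.\<close>
    have "branch l z = Some S" if "z \<in> child l y j" for z
      using that br(1) key_eq_cell(4)[of l z y] by (simp add: child_def)
    then have "G \<inter> child l y j \<subseteq> (H - X) \<inter> cell l y"
      using j(2) child_subset_cell[of l y j] H by auto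
    then have "card (G \<inter> child l y j) \<le> card ((H - X) \<inter> cell l y)"
      by (intro card_mono) auto
    then have "2 * (real m)\<^sup>2 * real (card (G \<inter> child l y j))
        \<le> 2 * (real m)\<^sup>2 * real (card ((H - X) \<inter> cell l y))"
      by (intro mult_left_mono) auto
    moreover have "card (L \<inter> cell l y) \<le> card (G \<inter> cell l y)"
      using H by (intro card_mono) (auto simp: L_def)
    ultimately show ?thesis
      using dense key_eq_cell(1)[OF ke] by simp
  qed simp
  moreover have "L \<subseteq> E" "H - X \<subseteq> E"
    using assms(2) H by (auto simp: L_def)
  ultimately have "real (card L) \<le> 2 * (real m)\<^sup>2 * real (card (H - X))"
    using card_cells_mono[of L "H - X" l] by blast
  moreover have "card {e \<in> H. \<exists>j \<in> S. X \<inter> child l e j = {}} \<le> card ({e \<in> G. skew G l e} \<union> L)"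
    using fin H by (intro card_mono) (auto simp: L_def)
  then have "card {e \<in> H. \<exists>j \<in> S. X \<inter> child l e j = {}} \<le> card {e \<in> G. skew G l e} + card L"
    using card_Un_le order_trans by blast
  ultimately show ?thesis by linarith
qed

text \<open>Depends on \<open>m\<close> and \<open>\<tau>\<close> only, so row and column colours
  range over the same set.\<close>

definition types :: "nat set set" where
  "types = {S. S \<subseteq> {..<m} \<and> card S = \<tau>}"

lemma finite_types [simp]: "finite types"
  by (rule finite_subset[of _ "Pow {..<m}"]) (auto simp: types_def)

lemma card_types_le: "card types \<le> m ^ \<tau>"
proof (cases "\<tau> \<le> m")
  case True
  then show ?thesis
    by (simp add: types_def n_subsets binomial_le_pow)
qed (simp add: types_def n_subsets binomial_eq_0)

lemma branch_types: "branch l e = Some S \<Longrightarrow> S \<in> types"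
  using branch_SomeD[of l e S] heavy_less[of l e] by (auto simp: types_def)

lemma sum_types_branch:
  "(\<Sum>S \<in> types. of_bool (branch l e = Some S)) = (of_bool (branch l e \<noteq> None) :: real)"
proof (cases "branch l e")
  case (Some T)
  then have "(\<Sum>S \<in> types. of_bool (branch l e = Some S)) = (\<Sum>S \<in> types. if S = T then 1 else 0 :: real)"
    by (intro sum.cong) auto
  then show ?thesis using Some branch_types[OF Some] by simp
qed simp

end

section \<open>Row and column cells together\<close>

locale two_filtrations =
  R: digit_filtration E rkey rdig m K \<tau> + C: digit_filtration E ckey cdig m K \<tau>
  for E :: "'e set" and rkey :: "nat \<Rightarrow> 'e \<Rightarrow> 'k" and rdig
    and ckey :: "nat \<Rightarrow> 'e \<Rightarrow> 'k" and cdig and m K \<tau>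
begin

definition rclass :: "nat \<Rightarrow> nat set \<Rightarrow> 'e set" where
  "rclass l S = {e \<in> E. R.branch l e = Some S}"

definition cclass :: "nat \<Rightarrow> nat set \<Rightarrow> 'e set" where
  "cclass l S = {e \<in> E. C.branch l e = Some S}"

text \<open>Each stage buys one move: from stage \<open>Suc i\<close> the embedding can go to any
  selected child of the row cell or of the column cell and still be at stage
  \<open>i\<close>.\<close>

fun reach :: "nat \<Rightarrow> nat \<Rightarrow> nat set \<Rightarrow> nat set \<Rightarrow> nat \<Rightarrow> 'e set" where
  "reach l l' S S' 0 = rclass l S \<inter> cclass l' S'"
| "reach l l' S S' (Suc i) = {e \<in> reach l l' S S' i.
     (\<forall>j \<in> S. reach l l' S S' i \<inter> R.child l e j \<noteq> {}) \<and>
     (\<forall>j \<in> S'. reach l l' S S' i \<inter> C.child l' e j \<noteq> {})}"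

text \<open>Each class is tested along the opposite filtration: the row colour is constant on a row
  cell at level \<open>l\<close>, so only the share of the column class can vary among its children,
  and conversely.\<close>

definition defect :: "nat \<Rightarrow> nat \<Rightarrow> nat set \<Rightarrow> nat set \<Rightarrow> real" where
  "defect l l' S S' = real (card {e \<in> cclass l' S'. R.skew (cclass l' S') l e})
     + real (card {e \<in> rclass l S. C.skew (rclass l S) l' e})"

lemma rclass_subset: "rclass l S \<subseteq> E" and cclass_subset: "cclass l S \<subseteq> E"
  by (auto simp: rclass_def cclass_def)

lemma reach_subset: "reach l l' S S' i \<subseteq> rclass l S \<inter> cclass l' S'"
  by (induction i) auto

text \<open>By \<open>card_lost_le\<close> in both directions, one more stage multiplies the loss by
  at most \<open>1 + 4 * m^2\<close> and adds one \<open>defect\<close>; as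
  \<open>m \<ge> 2\<close>, the factor \<open>5 * m^2\<close> absorbs both.\<close>

lemma card_unreached_le:
  assumes "l < K" "l' < K"
  shows "real (card (rclass l S \<inter> cclass l' S' - reach l l' S S' i))
    \<le> (5 * (real m)\<^sup>2) ^ i * defect l l' S S'"
proof (induction i)
  case 0
  then show ?case by (simp add: defect_def)
next
  case (Suc i)
  define H where "H = rclass l S \<inter> cclass l' S'"
  define X where "X = reach l l' S S' i"
  define A where "A = {e \<in> H. \<exists>j \<in> S. X \<inter> R.child l e j = {}}"
  define B where "B = {e \<in> H. \<exists>j \<in> S'. X \<inter> C.child l' e j = {}}"
  have m: "real m \<ge> 2" using R.base_ge_2 by simp
  have X: "X \<subseteq> H" using reach_subset by (auto simp: X_def H_def)
  have fin: "finite H" using finite_subset[OF rclass_subset R.finite_E] by (simp add: H_def)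
  have defect0: "defect l l' S S' \<ge> 0" by (simp add: defect_def)
  have "H - reach l l' S S' (Suc i) \<subseteq> (H - X) \<union> A \<union> B"
    by (auto simp: A_def B_def X_def)
  then have "card (H - reach l l' S S' (Suc i)) \<le> card ((H - X) \<union> A \<union> B)"
    using fin by (intro card_mono) (auto simp: A_def B_def)
  also have "\<dots> \<le> card (H - X) + card A + card B"
    by (meson add_mono card_Un_le order_trans order_refl)
  finally have "real (card (H - reach l l' S S' (Suc i)))
      \<le> real (card (H - X)) + real (card A) + real (card B)" by linarith
  moreover have "real (card A) \<le> real (card {e \<in> cclass l' S'. R.skew (cclass l' S') l e})
      + 2 * (real m)\<^sup>2 * real (card (H - X))"
    unfolding A_def using X assms(1)
    by (intro R.card_lost_le) (auto simp: H_def rclass_def cclass_def)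
  moreover have "real (card B) \<le> real (card {e \<in> rclass l S. C.skew (rclass l S) l' e})
      + 2 * (real m)\<^sup>2 * real (card (H - X))"
    unfolding B_def using X assms(2)
    by (intro C.card_lost_le) (auto simp: H_def rclass_def cclass_def)
  ultimately have "real (card (H - reach l l' S S' (Suc i)))
      \<le> (1 + 4 * (real m)\<^sup>2) * real (card (H - X)) + defect l l' S S'"
    by (simp add: defect_def algebra_simps)
  also have "\<dots> \<le> (1 + 4 * (real m)\<^sup>2) * ((5 * (real m)\<^sup>2) ^ i * defect l l' S S')
      + (5 * (real m)\<^sup>2) ^ i * defect l l' S S'"
  proof (intro add_mono mult_left_mono)
    show "real (card (H - X)) \<le> (5 * (real m)\<^sup>2) ^ i * defect l l' S S'"
      using Suc.IH by (simp add: H_def X_def)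
    have "1 \<le> (real m)\<^sup>2" using m by (intro one_le_power) simp
    then have "1 \<le> (5 * (real m)\<^sup>2) ^ i" by (intro one_le_power) simp
    then show "defect l l' S S' \<le> (5 * (real m)\<^sup>2) ^ i * defect l l' S S'"
      using defect0 by (simp add: mult_le_cancel_right1)
  qed simp
  also have "\<dots> = (2 + 4 * (real m)\<^sup>2) * ((5 * (real m)\<^sup>2) ^ i * defect l l' S S')"
    by (simp add: algebra_simps)
  also have "\<dots> \<le> (5 * (real m)\<^sup>2) * ((5 * (real m)\<^sup>2) ^ i * defect l l' S S')"
  proof (rule mult_right_mono)
    have "2 * 2 \<le> real m * real m" using m by (intro mult_mono) auto
    then show "2 + 4 * (real m)\<^sup>2 \<le> 5 * (real m)\<^sup>2" by (simp add: power2_eq_square)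
  qed (use defect0 in simp)
  finally show ?case by (simp add: H_def mult_ac)
qed

text \<open>Double counting: an entry with \<open>a\<close> branching row levels and
  \<open>b\<close> branching column levels lies in \<open>a * b\<close> of the intersections, since
  a branching cell has exactly one colour.\<close>

lemma sum_class_sizes_ge:
  assumes "2 * card {e \<in> E. N \<le> card {l. l < K \<and> R.branch l e \<noteq> None}
      \<and> N \<le> card {l. l < K \<and> C.branch l e \<noteq> None}} \<ge> card E"
  shows "real N ^ 2 * real (card E) / 2
    \<le> (\<Sum>l<K. \<Sum>l'<K. \<Sum>S \<in> R.types. \<Sum>S' \<in> R.types. real (card (rclass l S \<inter> cclass l' S')))"
proof -
  define a where "a e = card {l. l < K \<and> R.branch l e \<noteq> None}" for e
  define b where "b e = card {l. l < K \<and> C.branch l e \<noteq> None}" for e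
  define x where "x l S e = (of_bool (R.branch l e = Some S) :: real)" for l S e
  define y where "y l S e = (of_bool (C.branch l e = Some S) :: real)" for l S e
  have x: "(\<Sum>l<K. \<Sum>S \<in> R.types. x l S e) = real (a e)" for e
    unfolding x_def R.sum_types_branch by (simp add: a_def Collect_conj_eq lessThan_def)
  have y: "(\<Sum>l<K. \<Sum>S \<in> R.types. y l S e) = real (b e)" for e
    unfolding y_def C.sum_types_branch by (simp add: b_def Collect_conj_eq lessThan_def)
  have "real N ^ 2 * real (card E) / 2 \<le> real N ^ 2 * real (card {e \<in> E. N \<le> a e \<and> N \<le> b e})"
    using mult_left_mono[OF of_nat_mono[OF assms, where ?'a = real], of "real N ^ 2"]
    unfolding a_def b_def by (simp add: mult_ac)
  also have "\<dots> = (\<Sum>e \<in> {e \<in> E. N \<le> a e \<and> N \<le> b e}. real N * real N)"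
    by (simp add: power2_eq_square)
  also have "\<dots> \<le> (\<Sum>e \<in> {e \<in> E. N \<le> a e \<and> N \<le> b e}. real (a e) * real (b e))"
    by (intro sum_mono mult_mono) auto
  also have "\<dots> \<le> (\<Sum>e \<in> E. real (a e) * real (b e))"
    by (intro sum_mono2) auto
  also have "\<dots> = (\<Sum>e \<in> E. \<Sum>l<K. \<Sum>l'<K. \<Sum>S \<in> R.types. \<Sum>S' \<in> R.types. x l S e * y l' S' e)"
    by (simp add: x[symmetric] y[symmetric] sum_product)
  also have "\<dots> = (\<Sum>l<K. \<Sum>l'<K. \<Sum>S \<in> R.types. \<Sum>S' \<in> R.types. \<Sum>e \<in> E. x l S e * y l' S' e)"
    by (simp only: sum.swap[of _ _ E])
  also have "\<dots> = (\<Sum>l<K. \<Sum>l'<K. \<Sum>S \<in> R.types. \<Sum>S' \<in> R.types. real (card (rclass l S \<inter> cclass l' S')))"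
  proof (intro sum.cong refl)
    fix l l' S S'
    have "(\<Sum>e \<in> E. x l S e * y l' S' e)
        = (\<Sum>e \<in> E. of_bool (R.branch l e = Some S \<and> C.branch l' e = Some S'))"
      by (simp add: x_def y_def of_bool_conj)
    also have "\<dots> = real (card (E \<inter> {e. R.branch l e = Some S \<and> C.branch l' e = Some S'}))"
      using R.finite_E by (subst sum_of_bool_eq) auto
    also have "E \<inter> {e. R.branch l e = Some S \<and> C.branch l' e = Some S'} = rclass l S \<inter> cclass l' S'"
      by (auto simp: rclass_def cclass_def)
    finally show "(\<Sum>e \<in> E. x l S e * y l' S' e) = real (card (rclass l S \<inter> cclass l' S'))" .
  qed
  finally show ?thesis .
qed

text \<open>For a fixed class, \<open>sum_card_skew_le\<close> bounds the sum over the levels of the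
  opposite filtration. The class has \<open>K\<close> possible levels, and there are at most
  \<open>m ^ (2 * \<tau>)\<close> pairs of colours.\<close>

lemma sum_defect_le:
  assumes "0 < K"
  shows "(\<Sum>l<K. \<Sum>l'<K. \<Sum>S \<in> R.types. \<Sum>S' \<in> R.types. defect l l' S S')
    \<le> 8 * real m ^ (2 * \<tau> + 1) * (K * sqrt K) * card E"
proof -
  define T where "T = real (card R.types)"
  define B where "B = 4 * real m * sqrt K * card E"
  define f where "f l l' S' = real (card {e \<in> cclass l' S'. R.skew (cclass l' S') l e})" for l l' S'
  define g where "g l l' S = real (card {e \<in> rclass l S. C.skew (rclass l S) l' e})" for l l' S
  have "(\<Sum>l<K. \<Sum>l'<K. \<Sum>S \<in> R.types. \<Sum>S' \<in> R.types. f l l' S')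
      = (\<Sum>l'<K. \<Sum>l<K. \<Sum>S \<in> R.types. \<Sum>S' \<in> R.types. f l l' S')"
    by (rule sum.swap)
  also have "\<dots> = (\<Sum>S \<in> R.types. \<Sum>S' \<in> R.types. \<Sum>l'<K. \<Sum>l<K. f l l' S')"
    by (simp only: sum.swap[of _ R.types "{..<K}"])
  also have "\<dots> \<le> (\<Sum>S \<in> R.types. \<Sum>S' \<in> R.types. \<Sum>l'<K. B)"
    unfolding f_def B_def by (intro sum_mono R.sum_card_skew_le cclass_subset assms)
  finally have F: "(\<Sum>l<K. \<Sum>l'<K. \<Sum>S \<in> R.types. \<Sum>S' \<in> R.types. f l l' S') \<le> K * (T * (T * B))"
    by (simp add: T_def mult_ac)
  have "(\<Sum>l<K. \<Sum>l'<K. \<Sum>S \<in> R.types. \<Sum>S' \<in> R.types. g l l' S)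
      = (\<Sum>S \<in> R.types. \<Sum>S' \<in> R.types. \<Sum>l<K. \<Sum>l'<K. g l l' S)"
    by (simp only: sum.swap[of _ R.types "{..<K}"])
  also have "\<dots> \<le> (\<Sum>S \<in> R.types. \<Sum>S' \<in> R.types. \<Sum>l<K. B)"
    unfolding g_def B_def by (intro sum_mono C.sum_card_skew_le rclass_subset assms)
  finally have G: "(\<Sum>l<K. \<Sum>l'<K. \<Sum>S \<in> R.types. \<Sum>S' \<in> R.types. g l l' S) \<le> K * (T * (T * B))"
    by (simp add: T_def mult_ac)
  have T: "T \<le> real m ^ \<tau>" "0 \<le> T"
    using of_nat_mono[OF R.card_types_le, where ?'a = real] by (simp_all add: T_def)
  have B: "0 \<le> B" by (simp add: B_def)
  have "(\<Sum>l<K. \<Sum>l'<K. \<Sum>S \<in> R.types. \<Sum>S' \<in> R.types. defect l l' S S') \<le> 2 * K * (T * T * B)"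
    using F G by (simp add: defect_def f_def g_def sum.distrib)
  also have "\<dots> \<le> 2 * K * (real m ^ \<tau> * real m ^ \<tau> * B)"
    using T B by (intro mult_left_mono mult_right_mono mult_mono) auto
  also have "\<dots> = 8 * real m ^ (2 * \<tau> + 1) * (K * sqrt K) * card E"
    by (simp add: B_def power_even_eq power2_eq_square)
  finally show ?thesis .
qed

text \<open>Averaging: if stage \<open>k\<close> were always empty, every class intersection would
  be at most \<open>(5 * m^2) ^ k\<close> times its defect. The sizes add up to order
  \<open>N^2\<close>, the defects only to order \<open>K * sqrt K\<close>, which contradicts
  \<open>N\<close>.\<close>

lemma reach_nonempty:
  assumes size: "16 * real n * (2 * real \<tau>) ^ (2 * K) \<le> real (card E)" and "E \<noteq> {}"
    and roots: "card (rkey 0 ` E) \<le> n" "card (ckey 0 ` E) \<le> n"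
    and N: "m ^ N \<le> 2 ^ K" "16 * (5 * (real m)\<^sup>2) ^ k * real m ^ (2 * \<tau> + 1) * (K * sqrt K) < real N ^ 2"
  shows "\<exists>l<K. \<exists>l'<K. \<exists>S S'. reach l l' S S' k \<noteq> {}"
proof (rule ccontr)
  assume contra: "\<not> ?thesis"
  have E: "real (card E) > 0" using assms(2) by (simp add: card_gt_0_iff)
  define a where "a e = card {l. l < K \<and> R.branch l e \<noteq> None}" for e
  define b where "b e = card {l. l < K \<and> C.branch l e \<noteq> None}" for e
  \<comment> \<open>By \<open>size\<close> the error over the root cells is at most an eighth of
    \<open>E\<close>, so each direction excludes at most a quarter and half of the entries
    remain.\<close>
  have few: "real c \<le> n \<Longrightarrow> real (card E) / 8 + 2 * real c * (2 * real \<tau>) ^ (2 * K) \<le> real (card E) / 4" for c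
  proof -
    assume "real c \<le> n"
    then have "real c * (2 * real \<tau>) ^ (2 * K) \<le> real n * (2 * real \<tau>) ^ (2 * K)"
      by (intro mult_right_mono) auto
    then show ?thesis using size by linarith
  qed
  have "real (card {e \<in> E. a e < N}) \<le> real (card E) / 4" "real (card {e \<in> E. b e < N}) \<le> real (card E) / 4"
    using R.few_unbranched[OF N(1)] C.few_unbranched[OF N(1)] few roots
    unfolding a_def b_def by (meson of_nat_mono order_trans)+
  moreover have "card E \<le> card {e \<in> E. a e < N} + card {e \<in> E. b e < N} + card {e \<in> E. N \<le> a e \<and> N \<le> b e}"
  proof -
    have "E = {e \<in> E. a e < N} \<union> {e \<in> E. b e < N} \<union> {e \<in> E. N \<le> a e \<and> N \<le> b e}" by auto
    then show ?thesis by (metis (no_types, lifting) add_le_mono1 card_Un_le order_trans)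
  qed
  ultimately have "card E \<le> 2 * card {e \<in> E. N \<le> a e \<and> N \<le> b e}" by linarith
  then have "real N ^ 2 * real (card E) / 2
      \<le> (\<Sum>l<K. \<Sum>l'<K. \<Sum>S \<in> R.types. \<Sum>S' \<in> R.types. real (card (rclass l S \<inter> cclass l' S')))"
    unfolding a_def b_def by (rule sum_class_sizes_ge)
  also have "\<dots> \<le> (\<Sum>l<K. \<Sum>l'<K. \<Sum>S \<in> R.types. \<Sum>S' \<in> R.types. (5 * (real m)\<^sup>2) ^ k * defect l l' S S')"
  proof (intro sum_mono)
    fix l l' S S' assume "l \<in> {..<K}" "l' \<in> {..<K}"
    then show "real (card (rclass l S \<inter> cclass l' S')) \<le> (5 * (real m)\<^sup>2) ^ k * defect l l' S S'"
      using card_unreached_le[of l l' S S' k] contra by auto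
  qed
  also have "\<dots> = (5 * (real m)\<^sup>2) ^ k * (\<Sum>l<K. \<Sum>l'<K. \<Sum>S \<in> R.types. \<Sum>S' \<in> R.types. defect l l' S S')"
    by (simp add: sum_distrib_left)
  also have "\<dots> \<le> (5 * (real m)\<^sup>2) ^ k * (8 * real m ^ (2 * \<tau> + 1) * (K * sqrt K) * card E)"
  proof (cases "K = 0")
    case False
    then show ?thesis by (intro mult_left_mono sum_defect_le) auto
  qed simp
  finally have "real N ^ 2 * real (card E)
      \<le> 16 * (5 * (real m)\<^sup>2) ^ k * real m ^ (2 * \<tau> + 1) * (K * sqrt K) * real (card E)"
    by (simp add: mult_ac)
  then show False using N(2) E by (simp add: mult_le_cancel_right)
qed

end

section \<open>Embedding forests\<close>

text \<open>The first vertex of a longest path is a leaf: a further neighbour off the path would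
  extend it, one on the path would close a cycle.\<close>

lemma forest_leaf:
  assumes fin: "finite G" and "G \<noteq> {}" and edges: "\<And>e. e \<in> G \<Longrightarrow> \<exists>u v. u \<noteq> v \<and> e = {u, v}"
    and forest: "graph_forest G"
  shows "\<exists>u v. {u, v} \<in> G \<and> (\<forall>e \<in> G. u \<in> e \<longrightarrow> e = {u, v})"
proof -
  define path where "path vs \<longleftrightarrow> 2 \<le> length vs \<and> distinct vs \<and>
    (\<forall>k. Suc k < length vs \<longrightarrow> {vs ! k, vs ! Suc k} \<in> G)" for vs
  have finU: "finite (\<Union>G)"
    using fin edges by (metis finite.emptyI finite.insertI finite_Union)
  have bound: "length vs \<le> card (\<Union>G)" if "path vs" for vs
  proof -
    have "vs ! k \<in> \<Union>G" if k: "k < length vs" for k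
    proof (cases "Suc k < length vs")
      case True
      then have "{vs ! k, vs ! Suc k} \<in> G" using \<open>path vs\<close> by (simp add: path_def)
      then show ?thesis by blast
    next
      case False
      then obtain i where "k = Suc i" using k \<open>path vs\<close> by (cases k) (auto simp: path_def)
      then have "{vs ! i, vs ! k} \<in> G" using k \<open>path vs\<close> by (simp add: path_def)
      then show ?thesis by blast
    qed
    then have "set vs \<subseteq> \<Union>G" by (metis in_set_conv_nth subsetI)
    then have "card (set vs) \<le> card (\<Union>G)" using finU by (intro card_mono)
    then show ?thesis using \<open>path vs\<close> by (simp add: path_def distinct_card)
  qed
  obtain u v where "u \<noteq> v" "{u, v} \<in> G" using assms(2) edges by blast
  then have "path [u, v]" by (simp add: path_def)
  then have "\<exists>vs. path vs \<and> (\<forall>ws. path ws \<longrightarrow> length ws \<le> length vs)"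
    using bound by (intro ex_has_greatest_nat[where b = "Suc (card (\<Union>G))"]) (auto simp: less_Suc_eq_le)
  then obtain vs where vs: "path vs" and longest: "\<And>ws. path ws \<Longrightarrow> length ws \<le> length vs"
    by auto
  have two: "2 \<le> length vs" and dist: "distinct vs"
    and step: "\<And>k. Suc k < length vs \<Longrightarrow> {vs ! k, vs ! Suc k} \<in> G"
    using vs by (auto simp: path_def)
  have "e = {vs ! 0, vs ! 1}" if e: "e \<in> G" "vs ! 0 \<in> e" for e
  proof -
    obtain a b where "a \<noteq> b" "e = {a, b}" using edges[OF e(1)] by blast
    then obtain w where w: "w \<noteq> vs ! 0" "e = {vs ! 0, w}"
      using e(2) by (metis insert_commute insert_iff singletonD)
    have "w \<in> set vs"
    proof (rule ccontr)
      assume "w \<notin> set vs"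
      moreover have "{(w # vs) ! k, (w # vs) ! Suc k} \<in> G" if "Suc k < length (w # vs)" for k
        using that e(1) w(2) step by (cases k) (auto simp: insert_commute)
      ultimately have "path (w # vs)" using two dist by (simp add: path_def)
      then show False using longest by force
    qed
    then obtain k where k: "k < length vs" "w = vs ! k" by (metis in_set_conv_nth)
    have "k = 1"
    proof (rule ccontr)
      assume "k \<noteq> 1"
      moreover have "k \<noteq> 0" using k(2) w(1) by (intro notI) simp
      ultimately have "2 \<le> k" by simp
      \<comment> \<open>At \<open>i = k\<close> the index wraps around, and \<open>e\<close> is the
        closing edge from \<open>vs ! k\<close> to \<open>vs ! 0\<close>.\<close>
      have "{vs ! i, vs ! (Suc i mod Suc k)} \<in> G" if "i < Suc k" for i
        using that k e(1) w(2) step[of i] by (cases "i = k") (auto simp: insert_commute)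
      moreover have "length (take (Suc k) vs) = Suc k" using k(1) by simp
      ultimately have "graph_cycle G (take (Suc k) vs)"
        using \<open>2 \<le> k\<close> dist by (simp add: graph_cycle_def del: length_take)
      then show False using forest by (auto simp: graph_forest_def)
    qed
    then show ?thesis using w(2) k(2) by simp
  qed
  moreover have "{vs ! 0, vs ! 1} \<in> G" using step[of 0] two by simp
  ultimately show ?thesis by blast
qed

text \<open>Takes index pairs instead of a matrix, so that an induction can delete single
  edges.\<close>

definition bipartite :: "(nat \<times> nat) set \<Rightarrow> (nat + nat) set set" where
  "bipartite F = (\<lambda>(i, j). {Inl i, Inr j}) ` F"

lemma bipartite_leaf:
  assumes "finite F" "F \<noteq> {}" "graph_forest (bipartite F)"
  shows "\<exists>i j. (i, j) \<in> F \<and> ((\<forall>j'. (i, j') \<in> F \<longrightarrow> j' = j) \<or> (\<forall>i'. (i', j) \<in> F \<longrightarrow> i' = i))"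
proof -
  have "\<exists>u v. {u, v} \<in> bipartite F \<and> (\<forall>e \<in> bipartite F. u \<in> e \<longrightarrow> e = {u, v})"
    using assms by (intro forest_leaf) (force simp: bipartite_def)+
  then obtain u v where uv: "{u, v} \<in> bipartite F"
    and leaf: "\<And>e. e \<in> bipartite F \<Longrightarrow> u \<in> e \<Longrightarrow> e = {u, v}" by blast
  have edge: "{Inl i', Inr j'} \<in> bipartite F" if "(i', j') \<in> F" for i' j'
    using that by (force simp: bipartite_def)
  from uv obtain i j where ij: "(i, j) \<in> F" "{u, v} = {Inl i, Inr j}"
    by (auto simp: bipartite_def)
  have "u = Inl i \<or> u = Inr j" using ij(2) by blast
  then show ?thesis
  proof
    assume u: "u = Inl i"
    have "j' = j" if "(i, j') \<in> F" for j'
      using leaf[OF edge[OF that]] ij(2) u by (auto simp: doubleton_eq_iff)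
    then show ?thesis using ij(1) by blast
  next
    assume u: "u = Inr j"
    have "i' = i" if "(i', j) \<in> F" for i'
      using leaf[OF edge[OF that]] ij(2) u by (auto simp: doubleton_eq_iff)
    then show ?thesis using ij(1) by blast
  qed
qed

lemma graph_forest_subset: "graph_forest G \<Longrightarrow> G' \<subseteq> G \<Longrightarrow> graph_forest G'"
  unfolding graph_forest_def graph_cycle_def by blast

text \<open>Delete a leaf edge, embed the rest one stage higher, and spend that stage on moving the
  leaf into its slot next to its neighbour. Every vertex, even an isolated one, is required to lie
  on an entry of \<open>X d\<close>; this supplies an entry at the neighbour when its other edges
  are gone.\<close>

lemma embed_forest:
  fixes X :: "nat \<Rightarrow> ('a \<times> 'b) set"
  assumes anti: "\<And>i. X (Suc i) \<subseteq> X i"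
    and row: "\<And>i r c j. (r, c) \<in> X (Suc i) \<Longrightarrow> j < \<tau> \<Longrightarrow> \<exists>c' \<in> CB j. (r, c') \<in> X i"
    and col: "\<And>i r c j. (r, c) \<in> X (Suc i) \<Longrightarrow> j < \<tau> \<Longrightarrow> \<exists>r' \<in> RB j. (r', c) \<in> X i"
    and "finite F" "F \<subseteq> {..<\<tau>} \<times> {..<\<tau>}" "graph_forest (bipartite F)"
    and "X (Suc (card F + d)) \<noteq> {}"
  shows "\<exists>\<rho> \<kappa>. (\<forall>i<\<tau>. \<rho> i \<in> RB i \<and> (\<exists>c. (\<rho> i, c) \<in> X d))
    \<and> (\<forall>j<\<tau>. \<kappa> j \<in> CB j \<and> (\<exists>r. (r, \<kappa> j) \<in> X d)) \<and> (\<forall>(i, j) \<in> F. (\<rho> i, \<kappa> j) \<in> X d)"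
  using assms(4-)
proof (induction "card F" arbitrary: F d)
  case 0
  then have F: "F = {}" by simp
  \<comment> \<open>The extra \<open>Suc\<close> is used here: from one entry \<open>(r, c)\<close>
    all rows are placed along column \<open>c\<close> and all columns along row \<open>r\<close>,
    with no edge to respect.\<close>
  with 0 obtain r c where rc: "(r, c) \<in> X (Suc d)" by auto
  have "\<forall>i. \<exists>r'. i < \<tau> \<longrightarrow> r' \<in> RB i \<and> (r', c) \<in> X d" using col[OF rc] by blast
  then obtain \<rho> where \<rho>: "\<forall>i. i < \<tau> \<longrightarrow> \<rho> i \<in> RB i \<and> (\<rho> i, c) \<in> X d"
    by (rule exE[OF choice])
  have "\<forall>j. \<exists>c'. j < \<tau> \<longrightarrow> c' \<in> CB j \<and> (r, c') \<in> X d" using row[OF rc] by blast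
  then obtain \<kappa> where \<kappa>: "\<forall>j. j < \<tau> \<longrightarrow> \<kappa> j \<in> CB j \<and> (r, \<kappa> j) \<in> X d"
    by (rule exE[OF choice])
  show ?case
    unfolding F using \<rho> \<kappa> by (intro exI[of _ \<rho>] exI[of _ \<kappa>]) auto
next
  case (Suc f)
  then have "F \<noteq> {}" by auto
  then obtain i j where ij: "(i, j) \<in> F"
    and leaf: "(\<forall>j'. (i, j') \<in> F \<longrightarrow> j' = j) \<or> (\<forall>i'. (i', j) \<in> F \<longrightarrow> i' = i)"
    using bipartite_leaf Suc.prems by blast
  define F' where "F' = F - {(i, j)}"
  have lt: "i < \<tau>" "j < \<tau>" using ij Suc.prems by auto
  have "f = card F'" using Suc.hyps(2) ij Suc.prems(1) by (simp add: F'_def)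
  moreover have "graph_forest (bipartite F')"
    using Suc.prems(3) by (rule graph_forest_subset) (auto simp: F'_def bipartite_def)
  \<comment> \<open>One edge fewer and one stage higher leave the index of \<open>X\<close>
    unchanged.\<close>
  moreover have "X (Suc (card F' + Suc d)) \<noteq> {}"
    using Suc.prems(4) calculation(1) Suc.hyps(2) by (metis add_Suc add_Suc_right)
  ultimately obtain \<rho> \<kappa> where IH: "\<forall>i<\<tau>. \<rho> i \<in> RB i \<and> (\<exists>c. (\<rho> i, c) \<in> X (Suc d))"
    "\<forall>j<\<tau>. \<kappa> j \<in> CB j \<and> (\<exists>r. (r, \<kappa> j) \<in> X (Suc d))" "\<forall>(i, j) \<in> F'. (\<rho> i, \<kappa> j) \<in> X (Suc d)"
    using Suc.hyps(1)[of F' "Suc d"] Suc.prems(1,2) unfolding F'_def by blast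
  from leaf show ?case
  proof
    assume leaf: "\<forall>j'. (i, j') \<in> F \<longrightarrow> j' = j"
    \<comment> \<open>Row \<open>i\<close> occurs in no edge of \<open>F'\<close>, so
      \<open>\<rho> i\<close> can be redefined freely; the other edges descend to \<open>X d\<close>
      by \<open>anti\<close>.\<close>
    obtain r where "(r, \<kappa> j) \<in> X (Suc d)" using IH(2) lt by blast
    then obtain r' where r': "r' \<in> RB i" "(r', \<kappa> j) \<in> X d" using col lt by blast
    have "\<forall>i'<\<tau>. (\<rho>(i := r')) i' \<in> RB i' \<and> (\<exists>c. ((\<rho>(i := r')) i', c) \<in> X d)"
      using IH(1) r' anti by fastforce
    moreover have "\<forall>(i', j') \<in> F. ((\<rho>(i := r')) i', \<kappa> j') \<in> X d"
      using IH(3) r' leaf anti by (fastforce simp: F'_def)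
    ultimately show ?thesis
      using IH(2) anti by (intro exI[of _ "\<rho>(i := r')"] exI[of _ \<kappa>]) blast
  next
    assume leaf: "\<forall>i'. (i', j) \<in> F \<longrightarrow> i' = i"
    obtain c where "(\<rho> i, c) \<in> X (Suc d)" using IH(1) lt by blast
    then obtain c' where c': "c' \<in> CB j" "(\<rho> i, c') \<in> X d" using row lt by blast
    have "\<forall>j'<\<tau>. (\<kappa>(j := c')) j' \<in> CB j' \<and> (\<exists>r. (r, (\<kappa>(j := c')) j') \<in> X d)"
      using IH(2) c' anti by fastforce
    moreover have "\<forall>(i', j') \<in> F. (\<rho> i', (\<kappa>(j := c')) j') \<in> X d"
      using IH(3) c' leaf anti by (fastforce simp: F'_def)
    ultimately show ?thesis
      using IH(1) anti by (intro exI[of _ \<rho>] exI[of _ "\<kappa>(j := c')"]) blast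
  qed
qed

section \<open>Digit expansions and the order of indices\<close>

lemma div_power_Suc_eq_iff:
  fixes a b m :: nat
  assumes "l < K"
  shows "a div m ^ (K - Suc l) = b div m ^ (K - Suc l) \<longleftrightarrow>
    a div m ^ (K - l) = b div m ^ (K - l) \<and>
    a div m ^ (K - Suc l) mod m = b div m ^ (K - Suc l) mod m"
proof -
  have "K - l = Suc (K - Suc l)" using assms by simp
  then have "x div m ^ (K - l) = x div m ^ (K - Suc l) div m" for x
    by (simp only: power_Suc2 div_mult2_eq)
  then show ?thesis by (metis div_mult_mod_eq)
qed

text \<open>Lexicographic comparison. It turns increasing digits after a common prefix into
  increasing rows and columns.\<close>

lemma digit_less_imp_less:
  fixes a b m :: nat
  assumes "l < K" "a div m ^ (K - l) = b div m ^ (K - l)"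
    and "a div m ^ (K - Suc l) mod m < b div m ^ (K - Suc l) mod m"
  shows "a < b"
proof (rule ccontr)
  assume "\<not> a < b"
  then have le: "b div m ^ (K - Suc l) \<le> a div m ^ (K - Suc l)" by (simp add: div_le_mono)
  have "K - l = Suc (K - Suc l)" using assms(1) by simp
  then have *: "x div m ^ (K - l) = x div m ^ (K - Suc l) div m" for x
    by (simp only: power_Suc2 div_mult2_eq)
  have "a div m ^ (K - Suc l) < b div m ^ (K - Suc l)"
    using assms(2,3) unfolding * by (metis div_mult_mod_eq nat_add_left_cancel_less)
  with le show False by simp
qed

lemma sorted_list_nth_props:
  fixes S :: "nat set"
  assumes "finite S" "card S = \<tau>"
  shows "\<And>i. i < \<tau> \<Longrightarrow> sorted_list_of_set S ! i \<in> S"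
    and "\<And>i j. i < j \<Longrightarrow> j < \<tau> \<Longrightarrow> sorted_list_of_set S ! i < sorted_list_of_set S ! j"
proof -
  show "sorted_list_of_set S ! i \<in> S" if "i < \<tau>" for i
    using that assms by (metis length_sorted_list_of_set nth_mem set_sorted_list_of_set)
  show "sorted_list_of_set S ! i < sorted_list_of_set S ! j" if "i < j" "j < \<tau>" for i j
    using that assms strict_sorted_list_of_set[of S]
    by (simp add: sorted_wrt_iff_nth_less)
qed

text \<open>\<open>reach_nonempty\<close> supplies an entry with one stage for each edge and one
  more for the base case of \<open>embed_forest\<close>; the selected digits in increasing order
  serve as slots.\<close>

theorem dense_edges_contain_forest:
  fixes E F :: "(nat \<times> nat) set"
  assumes E: "E \<subseteq> {..<n} \<times> {..<n}" "E \<noteq> {}"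
    and F: "F \<subseteq> {..<\<tau>} \<times> {..<\<tau>}" "graph_forest (bipartite F)"
    and "0 < \<tau>" "2 \<le> m" "n \<le> m ^ K"
    and size: "16 * real n * (2 * real \<tau>) ^ (2 * K) \<le> real (card E)"
    and N: "m ^ N \<le> 2 ^ K"
      "16 * (5 * (real m)\<^sup>2) ^ Suc (card F) * real m ^ (2 * \<tau> + 1) * (K * sqrt K) < real N ^ 2"
  shows "\<exists>\<rho> \<kappa>. strict_mono_on {..<\<tau>} \<rho> \<and> strict_mono_on {..<\<tau>} \<kappa>
    \<and> \<rho> ` {..<\<tau>} \<subseteq> {..<n} \<and> \<kappa> ` {..<\<tau>} \<subseteq> {..<n} \<and> (\<forall>(i, j) \<in> F. (\<rho> i, \<kappa> j) \<in> E)"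
proof -
  \<comment> \<open>For \<open>a < m ^ K\<close>, the quotient \<open>a div m ^ (K - l)\<close>
    consists of the first \<open>l\<close> of \<open>K\<close> digits. A row cell fixes the row and
    a prefix of the column; at \<open>l = K\<close> this is the whole entry.\<close>
  define rkey ckey rdig cdig :: "nat \<Rightarrow> nat \<times> nat \<Rightarrow> _"
    where keys: "rkey = (\<lambda>l e. (fst e, snd e div m ^ (K - l)))"
      "ckey = (\<lambda>l e. (snd e, fst e div m ^ (K - l)))"
      "rdig = (\<lambda>l e. snd e div m ^ (K - Suc l) mod m)"
      "cdig = (\<lambda>l e. fst e div m ^ (K - Suc l) mod m)"
  have finE: "finite E" using E(1) by (rule finite_subset) simp
  interpret two_filtrations E rkey rdig ckey cdig m K \<tau>
  proof
    show "finite E" "2 \<le> m" "0 < \<tau>" by fact+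
    show "inj_on (rkey K) E" "inj_on (ckey K) E"
      by (auto simp: keys inj_on_def)
    fix l and e e' :: "nat \<times> nat"
    show "rdig l e < m" "cdig l e < m" using \<open>2 \<le> m\<close> by (simp_all add: keys)
    assume "l < K"
    then show "rkey (Suc l) e = rkey (Suc l) e' \<longleftrightarrow> rkey l e = rkey l e' \<and> rdig l e = rdig l e'"
      "ckey (Suc l) e = ckey (Suc l) e' \<longleftrightarrow> ckey l e = ckey l e' \<and> cdig l e = cdig l e'"
      using div_power_Suc_eq_iff[of l K] by (auto simp: keys)
  qed
  \<comment> \<open>At level 0 the prefix is empty, so there are at most \<open>n\<close> root cells
    in each direction.\<close>
  have root: "e div m ^ K = 0" if "e < n" for e using that assms(7) by simp
  have "rkey 0 ` E \<subseteq> {..<n} \<times> {0}" "ckey 0 ` E \<subseteq> {..<n} \<times> {0}"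
    using E(1) root by (auto simp: keys)
  then have "card (rkey 0 ` E) \<le> card ({..<n} \<times> {0::nat})" "card (ckey 0 ` E) \<le> card ({..<n} \<times> {0::nat})"
    by (intro card_mono; simp)+
  then have "\<exists>l<K. \<exists>l'<K. \<exists>S S'. reach l l' S S' (Suc (card F)) \<noteq> {}"
    using size E(2) N by (intro reach_nonempty[of n N]) (simp_all del: reach.simps)
  then obtain l l' S S' r0 c0 where l: "l < K" "l' < K"
    and rc0: "(r0, c0) \<in> reach l l' S S' (Suc (card F))" by fast
  \<comment> \<open>Moves inside a cell keep both prefixes, so everything reached shares those of
    \<open>(r0, c0)\<close> and the next digit decides the order.\<close>
  define X where "X i = reach l l' S S' i \<inter>
    {e. snd e div m ^ (K - l) = c0 div m ^ (K - l) \<and> fst e div m ^ (K - l') = r0 div m ^ (K - l')}" for i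
  have "R.branch l (r0, c0) = Some S" "C.branch l' (r0, c0) = Some S'"
    using rc0 reach_subset by (fastforce simp: rclass_def cclass_def)+
  then have "S \<in> R.types" "S' \<in> R.types" using R.branch_types C.branch_types by auto
  then have S: "finite S" "card S = \<tau>" "finite S'" "card S' = \<tau>"
    by (auto simp: R.types_def intro: finite_subset)
  \<comment> \<open>Columns of the pattern use the row colour \<open>S\<close>, because a move
    inside a row cell changes the column; rows use \<open>S'\<close>.\<close>
  define CB where "CB j = {c. c div m ^ (K - l) = c0 div m ^ (K - l)
    \<and> c div m ^ (K - Suc l) mod m = sorted_list_of_set S ! j}" for j
  define RB where "RB i = {r. r div m ^ (K - l') = r0 div m ^ (K - l')
    \<and> r div m ^ (K - Suc l') mod m = sorted_list_of_set S' ! i}" for i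
  have "\<exists>\<rho> \<kappa>. (\<forall>i<\<tau>. \<rho> i \<in> RB i \<and> (\<exists>c. (\<rho> i, c) \<in> X 0))
    \<and> (\<forall>j<\<tau>. \<kappa> j \<in> CB j \<and> (\<exists>r. (r, \<kappa> j) \<in> X 0)) \<and> (\<forall>(i, j) \<in> F. (\<rho> i, \<kappa> j) \<in> X 0)"
  proof (rule embed_forest)
    show "X (Suc i) \<subseteq> X i" for i by (auto simp: X_def)
    show "finite F" using F(1) by (rule finite_subset) simp
    show "F \<subseteq> {..<\<tau>} \<times> {..<\<tau>}" "graph_forest (bipartite F)" by fact+
    show "X (Suc (card F + 0)) \<noteq> {}" using rc0 by (auto simp: X_def simp del: reach.simps)
    fix i r c j assume rc: "(r, c) \<in> X (Suc i)" and j: "j < \<tau>"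
    have "reach l l' S S' i \<inter> R.child l (r, c) (sorted_list_of_set S ! j) \<noteq> {}"
      using rc sorted_list_nth_props(1)[OF S(1,2) j] by (auto simp: X_def)
    then obtain c' where "(r, c') \<in> reach l l' S S' i" "c' div m ^ (K - l) = c div m ^ (K - l)"
      "c' div m ^ (K - Suc l) mod m = sorted_list_of_set S ! j"
      unfolding R.child_def by (auto simp: keys(1,3))
    then show "\<exists>c' \<in> CB j. (r, c') \<in> X i" using rc by (auto simp: X_def CB_def)
    have "reach l l' S S' i \<inter> C.child l' (r, c) (sorted_list_of_set S' ! j) \<noteq> {}"
      using rc sorted_list_nth_props(1)[OF S(3,4) j] by (auto simp: X_def)
    then obtain r' where "(r', c) \<in> reach l l' S S' i" "r' div m ^ (K - l') = r div m ^ (K - l')"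
      "r' div m ^ (K - Suc l') mod m = sorted_list_of_set S' ! j"
      unfolding C.child_def by (auto simp: keys(2,4))
    then show "\<exists>r' \<in> RB j. (r', c) \<in> X i" using rc by (auto simp: X_def RB_def)
  qed
  then obtain \<rho> \<kappa> where emb: "(\<forall>i<\<tau>. \<rho> i \<in> RB i \<and> (\<exists>c. (\<rho> i, c) \<in> X 0))
    \<and> (\<forall>j<\<tau>. \<kappa> j \<in> CB j \<and> (\<exists>r. (r, \<kappa> j) \<in> X 0)) \<and> (\<forall>(i, j) \<in> F. (\<rho> i, \<kappa> j) \<in> X 0)"
    by (elim exE) (rule that)
  then have \<rho>: "\<And>i. i < \<tau> \<Longrightarrow> \<rho> i \<in> RB i" and \<kappa>: "\<And>j. j < \<tau> \<Longrightarrow> \<kappa> j \<in> CB j"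
    and edges: "\<forall>(i, j) \<in> F. (\<rho> i, \<kappa> j) \<in> X 0" by simp_all
  have "\<rho> i < \<rho> j" if "i < j" "j < \<tau>" for i j
  proof (rule digit_less_imp_less[OF l(2), of _ m])
    show "\<rho> i div m ^ (K - l') = \<rho> j div m ^ (K - l')"
      "\<rho> i div m ^ (K - Suc l') mod m < \<rho> j div m ^ (K - Suc l') mod m"
      using \<rho>[of i] \<rho>[of j] that sorted_list_nth_props(2)[OF S(3,4) that] by (auto simp: RB_def)
  qed
  moreover have "\<kappa> i < \<kappa> j" if "i < j" "j < \<tau>" for i j
  proof (rule digit_less_imp_less[OF l(1), of _ m])
    show "\<kappa> i div m ^ (K - l) = \<kappa> j div m ^ (K - l)"
      "\<kappa> i div m ^ (K - Suc l) mod m < \<kappa> j div m ^ (K - Suc l) mod m"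
      using \<kappa>[of i] \<kappa>[of j] that sorted_list_nth_props(2)[OF S(1,2) that] by (auto simp: CB_def)
  qed
  moreover have "X 0 \<subseteq> E" using rclass_subset by (auto simp: X_def)
  moreover from this have "\<rho> i < n" "\<kappa> i < n" if "i < \<tau>" for i
    using emb that E(1) by blast+
  ultimately show ?thesis
    using edges by (intro exI[of _ \<rho>] exI[of _ \<kappa>]) (auto simp: strict_mono_on_def)
qed

section \<open>From increasing index maps to copies of a pattern\<close>

lemma card_less_image_strict_mono:
  fixes f :: "nat \<Rightarrow> nat"
  assumes "strict_mono_on {..<s} f" "i < s"
  shows "card {a \<in> f ` {..<s}. a < f i} = i"
proof -
  have "{a \<in> f ` {..<s}. a < f i} = f ` {..<i}"
    using assms by (auto simp: strict_mono_on_less)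
  moreover have "inj_on f {..<i}"
    using assms by (intro inj_on_subset[OF strict_mono_on_imp_inj_on[OF assms(1)]]) auto
  ultimately show ?thesis by (simp add: card_image)
qed

lemma contains_copyI:
  assumes "zero_one_mat M" "zero_one_mat P"
    and \<rho>: "strict_mono_on {..<dim_row P} \<rho>" "\<rho> ` {..<dim_row P} \<subseteq> {..<dim_row M}"
    and \<kappa>: "strict_mono_on {..<dim_col P} \<kappa>" "\<kappa> ` {..<dim_col P} \<subseteq> {..<dim_col M}"
    and ones: "\<And>i j. i < dim_row P \<Longrightarrow> j < dim_col P \<Longrightarrow> P $$ (i, j) = 1 \<Longrightarrow> M $$ (\<rho> i, \<kappa> j) = 1"
  shows "contains_copy M P"
proof -
  let ?I = "\<rho> ` {..<dim_row P}" and ?J = "\<kappa> ` {..<dim_col P}"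
  let ?B = "submatrix M ?I ?J"
  have "{i. i < dim_row M \<and> i \<in> ?I} = ?I" "{j. j < dim_col M \<and> j \<in> ?J} = ?J"
    using \<rho>(2) \<kappa>(2) by auto
  then have dims: "dim_row ?B = dim_row P" "dim_col ?B = dim_col P"
    using card_image[OF strict_mono_on_imp_inj_on[OF \<rho>(1)]]
      card_image[OF strict_mono_on_imp_inj_on[OF \<kappa>(1)]] by (simp_all add: dim_submatrix)
  have "P $$ (i, j) = ?B $$ (i, j) \<or> ?B $$ (i, j) = 1 \<and> P $$ (i, j) = 0"
    if ij: "i < dim_row P" "j < dim_col P" for i j
  proof -
    have lt: "\<rho> i < dim_row M" "\<kappa> j < dim_col M" using ij \<rho>(2) \<kappa>(2) by auto
    \<comment> \<open>\<open>submatrix\<close> numbers the chosen rows and columns by rank, and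
      \<open>\<rho> i\<close> and \<open>\<kappa> j\<close> have ranks \<open>i\<close> and
      \<open>j\<close>.\<close>
    have B: "?B $$ (i, j) = M $$ (\<rho> i, \<kappa> j)"
      using submatrix_index_card[OF lt, of ?I ?J] ij
        card_less_image_strict_mono[OF \<rho>(1)] card_less_image_strict_mono[OF \<kappa>(1)] by simp
    have "P $$ (i, j) \<in> elements_mat P" "M $$ (\<rho> i, \<kappa> j) \<in> elements_mat M"
      using ij lt by auto
    then have "P $$ (i, j) \<in> {0, 1}" "M $$ (\<rho> i, \<kappa> j) \<in> {0, 1}"
      using assms(1,2) unfolding zero_one_mat_def by blast+
    then show ?thesis using ones[OF ij] B by auto
  qed
  then have "deletes_to ?B P" by (simp add: deletes_to_def dims)
  then show ?thesis unfolding contains_copy_def using \<rho>(2) \<kappa>(2) by blast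
qed

section \<open>Choice of parameters\<close>

text \<open>The base is \<open>m = 2 ^ p\<close> and \<open>K = p * N\<close>, whence
  \<open>m ^ N = 2 ^ K\<close>. With \<open>p\<close> about \<open>log log n / (4 * h)\<close> a
  fixed power of \<open>m\<close> stays below \<open>log n\<close>, and with \<open>N\<close> about
  \<open>log n / p^2\<close> one has \<open>m ^ K \<ge> n\<close> while \<open>K\<close> is only of
  order \<open>log n / log log n\<close>.\<close>

lemma filtration_parameters:
  fixes n h \<tau> :: nat
  assumes n: "3 \<le> n" and h: "1 \<le> h" and "0 < \<tau>" and large: "4 * real h \<le> log 2 (log 2 (real n))"
  obtains p N where "0 < p" "0 < N" "n \<le> (2 ^ p) ^ (p * N)" "(2 ^ p) ^ (2 * h) < p * N"
    "16 * real n * (2 * real \<tau>) ^ (2 * (p * N))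
      \<le> real n powr (1 + 64 * real h * (1 + real \<tau>) / log 2 (log 2 (real n)))"
proof -
  define L where "L = log 2 (real n)"
  define q where "q = log 2 L / (4 * real h)"
  define p where "p = nat \<lfloor>q\<rfloor>"
  define N where "N = nat \<lceil>L / (real p)\<^sup>2\<rceil>"
  have q1: "1 \<le> q" using h large by (simp add: q_def L_def)
  have L: "1 < L"
    using n by (simp add: L_def)
  have p: "1 \<le> p" "real p \<le> q" "q < real p + 1"
    using q1 by (simp_all add: p_def le_nat_floor)
  have "real p * (4 * real h) \<le> log 2 L"
    using p(2) h by (simp add: q_def field_simps)
  then have "2 powr (real p * (4 * real h)) \<le> L"
    using L by (simp add: le_log_iff)
  moreover have "2 powr (real p * (4 * real h)) = real ((2 ^ p) ^ (4 * h))"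
    by (simp add: powr_realpow[symmetric] powr_powr flip: power_mult)
  ultimately have mL: "real ((2 ^ p) ^ (4 * h)) \<le> L" by simp
  have pm: "p < 2 ^ p" by simp
  have "p * (2 ^ p) ^ (2 * h) < 2 ^ p * (2 ^ p) ^ (2 * h)" using pm by simp
  also have "\<dots> = (2 ^ p) ^ Suc (2 * h)" by simp
  also have "\<dots> \<le> (2 ^ p) ^ (4 * h)" using h by (intro power_increasing) auto
  finally have "real (p * (2 ^ p) ^ (2 * h)) < L" using mL by linarith
  then have small: "real ((2 ^ p) ^ (2 * h)) < L / real p"
    using p(1) by (simp add: field_simps)
  \<comment> \<open>Needed to absorb the rounding in \<open>N\<close>, which adds at most
    \<open>p\<close> to \<open>p * N\<close>, into a second \<open>L / p\<close>.\<close>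
  have "p * p \<le> 2 ^ p * 2 ^ p" using pm by (intro mult_mono) auto
  also have "\<dots> = (2 ^ p) ^ 2" by (simp add: power2_eq_square)
  also have "\<dots> \<le> (2 ^ p) ^ (4 * h)" using h by (intro power_increasing) auto
  finally have pp: "real p * real p \<le> L" using mL by (metis of_nat_mono of_nat_mult order_trans)
  have "0 < L / (real p)\<^sup>2" using L p(1) by simp
  then have N: "0 < N" "L / (real p)\<^sup>2 \<le> real N" "real N < L / (real p)\<^sup>2 + 1"
    by (simp_all add: N_def) linarith+
  have K_ge: "L / real p \<le> real (p * N)" and pK_ge: "L \<le> real (p * (p * N))"
    using N(2) p(1) by (simp_all add: field_simps power2_eq_square)
  have "real (p * N) \<le> L / real p + real p"
    using N(3) p(1) by (simp add: field_simps power2_eq_square)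
  also have "\<dots> \<le> L / real p + L / real p" using pp p(1) by (simp add: field_simps)
  also have "L / real p + L / real p = 2 * (1 / real p) * L" by simp
  also have "\<dots> \<le> 2 * (2 / q) * L"
  proof -
    \<comment> \<open>Since \<open>p \<ge> 1\<close>, rounding down loses at most a factor
      2.\<close>
    have "q \<le> 2 * real p" using p(1,3) by linarith
    then have "1 / real p \<le> 2 / q" using p(1) q1 by (simp add: field_simps)
    then show ?thesis using L by (intro mult_right_mono mult_left_mono) auto
  qed
  also have "\<dots> = 16 * real h * L / log 2 L" by (simp add: q_def)
  finally have K_le: "real (p * N) \<le> 16 * real h * L / log 2 L" by simp
  have "real n = 2 powr L" using n by (simp add: L_def)
  also have "\<dots> \<le> 2 powr real (p * (p * N))" using pK_ge by simp
  also have "\<dots> = real ((2 ^ p) ^ (p * N))"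
    by (simp add: powr_realpow flip: power_mult del: of_nat_mult)
  finally have "n \<le> (2 ^ p) ^ (p * N)" by (simp only: of_nat_le_iff)
  moreover have "(2 ^ p) ^ (2 * h) < p * N"
    using small K_ge by (metis less_le_trans of_nat_less_iff)
  moreover have "16 * real n * (2 * real \<tau>) ^ (2 * (p * N))
      \<le> real n powr (1 + 64 * real h * (1 + real \<tau>) / log 2 (log 2 (real n)))"
  proof -
    have K1: "1 \<le> p * N" using p(1) N(1) by simp
    have "2 * real \<tau> \<le> 2 * 2 ^ \<tau>" by simp
    also have "\<dots> \<le> 2 ^ (2 * \<tau>)"
      using \<open>0 < \<tau>\<close> power_increasing[of "Suc \<tau>" "2 * \<tau>" "2 :: real"] by simp
    finally have "2 * real \<tau> \<le> 2 ^ (2 * \<tau>)" .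
    then have "(2 * real \<tau>) ^ (2 * (p * N)) \<le> (2 ^ (2 * \<tau>)) ^ (2 * (p * N))"
      by (intro power_mono) auto
    also have "\<dots> = 2 powr (4 * real \<tau> * real (p * N))"
      by (simp add: powr_realpow[symmetric] powr_powr mult_ac)
    finally have A: "(2 * real \<tau>) ^ (2 * (p * N)) \<le> 2 powr (4 * real \<tau> * real (p * N))" .
    \<comment> \<open>The exponents \<open>4 * K\<close> from 16 and \<open>4 * \<tau> * K\<close>
      from the power add up to \<open>4 * (1 + \<tau>) * K\<close>; \<open>K_le\<close> then turns 4
      into \<open>64 * h\<close>.\<close>
    have "(16 :: real) = 2 powr 4" by simp
    also have "\<dots> \<le> 2 powr (4 * real (p * N))"
      using of_nat_mono[OF K1, where ?'a = real] by (intro powr_mono) simp_all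
    finally have B: "16 \<le> 2 powr (4 * real (p * N))" .
    have "16 * (2 * real \<tau>) ^ (2 * (p * N)) \<le> 2 powr (4 * real (p * N)) * 2 powr (4 * real \<tau> * real (p * N))"
      using A B by (intro mult_mono) auto
    also have "\<dots> = 2 powr (4 * (1 + real \<tau>) * real (p * N))"
      by (simp add: algebra_simps flip: powr_add)
    also have "\<dots> \<le> 2 powr (4 * (1 + real \<tau>) * (16 * real h * L / log 2 L))"
      using K_le by (intro powr_mono mult_left_mono) auto
    also have "\<dots> = 2 powr (L * (64 * real h * (1 + real \<tau>) / log 2 L))"
      by (simp add: mult_ac)
    also have "\<dots> = real n powr (64 * real h * (1 + real \<tau>) / log 2 L)"
      unfolding powr_powr[symmetric] using \<open>real n = 2 powr L\<close> by simp
    finally have "real n * (16 * (2 * real \<tau>) ^ (2 * (p * N)))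
        \<le> real n * real n powr (64 * real h * (1 + real \<tau>) / log 2 L)"
      by (intro mult_left_mono) auto
    then show ?thesis using n by (simp add: powr_add L_def mult_ac)
  qed
  moreover have "0 < p" using p(1) by simp
  ultimately show ?thesis using that N(1) by blast
qed

text \<open>Multiplied by \<open>p^2\<close>, the right side is \<open>K^2\<close>, so all other
  factors must stay below \<open>sqrt K\<close>. By \<open>p \<le> m\<close>,
  \<open>16 \<le> m ^ 4\<close> and \<open>5 \<le> m ^ 3\<close> they are at most
  \<open>m ^ (2 + 4 + 5 * k + 2 * \<tau> + 1)\<close>, whose square is below
  \<open>K\<close>.\<close>

lemma branching_condition:
  fixes p N k \<tau> :: nat
  defines "m \<equiv> 2 ^ p" and "K \<equiv> p * N"
  assumes "0 < p" "0 < N" and large: "m ^ (2 * (5 * k + 2 * \<tau> + 7)) < K"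
  shows "16 * (5 * (real m)\<^sup>2) ^ k * real m ^ (2 * \<tau> + 1) * (K * sqrt K) < real N ^ 2"
proof -
  define h where "h = 5 * k + 2 * \<tau> + 7"
  have m: "real m \<ge> 2" using assms(3) power_increasing[of 1 p "2 :: real"] by (simp add: m_def)
  have pm: "real p \<le> real m" by (simp add: m_def less_imp_le)
  have K: "real K > 0" using assms(3,4) by (simp add: K_def)
  have "(real m ^ h)\<^sup>2 < real K"
  proof -
    have "real (m ^ (2 * h)) < real K" using large unfolding h_def by (simp only: of_nat_less_iff)
    then show ?thesis by (simp add: mult.commute flip: power_mult)
  qed
  then have root: "real m ^ h < sqrt K"
    by (intro real_less_rsqrt)
  have "16 \<le> real m ^ 4" "5 \<le> real m ^ 3"
    using power_mono[OF m, of 4] power_mono[OF m, of 3] by simp_all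
  then have "(real p)\<^sup>2 * (16 * (5 * (real m)\<^sup>2) ^ k * real m ^ (2 * \<tau> + 1))
      \<le> (real m)\<^sup>2 * (real m ^ 4 * (real m ^ 3 * (real m)\<^sup>2) ^ k * real m ^ (2 * \<tau> + 1))"
    using pm m by (intro mult_mono power_mono) auto
  also have "\<dots> = real m ^ h"
  proof -
    have "real m ^ 3 * (real m)\<^sup>2 = real m ^ 5" by (simp flip: power_add)
    moreover have "h = 2 + (4 + 5 * k + (2 * \<tau> + 1))" by (simp add: h_def)
    ultimately show ?thesis by (simp only: power_add power_mult)
  qed
  also have "\<dots> < sqrt K" by (rule root)
  finally have "(real p)\<^sup>2 * (16 * (5 * (real m)\<^sup>2) ^ k * real m ^ (2 * \<tau> + 1)) * (K * sqrt K)
      < sqrt K * (K * sqrt K)"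
    using K by (intro mult_strict_right_mono) auto
  also have "\<dots> = (real p)\<^sup>2 * (real N)\<^sup>2"
    using K by (simp add: K_def power2_eq_square mult_ac)
  finally have "(real p)\<^sup>2 * (16 * (5 * (real m)\<^sup>2) ^ k * real m ^ (2 * \<tau> + 1) * (K * sqrt K))
      < (real p)\<^sup>2 * (real N)\<^sup>2"
    by (simp only: mult.assoc)
  then show ?thesis using assms(3) by (simp add: mult_less_cancel_left_pos)
qed

theorem corollary2:
  fixes P :: "nat mat"
  assumes "zero_one_mat P" and "acyclic_mat P"
  shows "\<exists>C::real. C > 0 \<and>
    (\<forall>n::nat. n \<ge> 3 \<longrightarrow> real (Ex_mat n P) \<le> real n powr (1 + C / log 2 (log 2 (real n))))"
proof -
  \<comment> \<open>Enough slots for rows and columns alike; the summand 1 keeps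
    \<open>\<tau>\<close> positive for an empty pattern.\<close>
  define \<tau> where "\<tau> = dim_row P + dim_col P + 1"
  define F where "F = {(i, j). i < dim_row P \<and> j < dim_col P \<and> P $$ (i, j) = 1}"
  \<comment> \<open>The exponent in \<open>branching_condition\<close> for
    \<open>k = Suc (card F)\<close> stages.\<close>
  define h where "h = 5 * Suc (card F) + 2 * \<tau> + 7"
  define C where "C = 64 * real h * (1 + real \<tau>)"
  have "bipartite F = bipartite_edges P"
    by (auto simp: bipartite_def bipartite_edges_def F_def)
  then have forest: "graph_forest (bipartite F)"
    using assms(2) by (simp add: acyclic_mat_def)
  have F: "F \<subseteq> {..<\<tau>} \<times> {..<\<tau>}" by (auto simp: F_def \<tau>_def)
  have h: "1 \<le> h" by (simp add: h_def)
  have "4 * real h * 1 \<le> 4 * real h * (16 * (1 + real \<tau>))" by (intro mult_left_mono) auto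
  then have hC: "4 * real h \<le> C" by (simp add: C_def algebra_simps)
  have "real (weight M) \<le> real n powr (1 + C / log 2 (log 2 (real n)))"
    if n: "3 \<le> n" and M: "M \<in> carrier_mat n n" "zero_one_mat M" "\<not> contains_copy M P" for n M
  proof (cases "4 * real h \<le> log 2 (log 2 (real n))")
    case False
    \<comment> \<open>For such \<open>n\<close> the constant \<open>C\<close> exceeds
      \<open>log log n\<close>, the exponent is at least 2, and the trivial bound
      \<open>n * n\<close> suffices.\<close>
    have "1 < log 2 (real n)" using n by simp
    then have "0 < log 2 (log 2 (real n))" by simp
    then have "1 \<le> C / log 2 (log 2 (real n))" using False hC by simp
    then have "real n powr 2 \<le> real n powr (1 + C / log 2 (log 2 (real n)))"
      using n by (intro powr_mono) auto
    moreover have "real (weight M) \<le> real (n * n)"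
      using weight_le[of M] M(1) by (metis carrier_matD of_nat_mono)
    ultimately show ?thesis using n by (simp add: power2_eq_square)
  next
    case True
    have "0 < \<tau>" by (simp add: \<tau>_def)
    from filtration_parameters[OF n h this True] obtain p N where pN: "0 < p" "0 < N"
      "n \<le> (2 ^ p) ^ (p * N)" "(2 ^ p) ^ (2 * h) < p * N"
      "16 * real n * (2 * real \<tau>) ^ (2 * (p * N)) \<le> real n powr (1 + C / log 2 (log 2 (real n)))"
      unfolding C_def .
    define E where "E = {(i, j). i < n \<and> j < n \<and> M $$ (i, j) = 1}"
    have card_E: "weight M = card E" using M(1) by (simp add: weight_def E_def)
    show ?thesis
    proof (rule ccontr)
      assume "\<not> ?thesis"
      then have dense: "real n powr (1 + C / log 2 (log 2 (real n))) < real (card E)"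
        by (simp add: card_E)
      have "E \<noteq> {}" using dense by auto
      have "\<exists>\<rho> \<kappa>. strict_mono_on {..<\<tau>} \<rho> \<and> strict_mono_on {..<\<tau>} \<kappa>
          \<and> \<rho> ` {..<\<tau>} \<subseteq> {..<n} \<and> \<kappa> ` {..<\<tau>} \<subseteq> {..<n} \<and> (\<forall>(i, j) \<in> F. (\<rho> i, \<kappa> j) \<in> E)"
      proof (rule dense_edges_contain_forest)
        show "E \<subseteq> {..<n} \<times> {..<n}" by (auto simp: E_def)
        show "2 \<le> (2::nat) ^ p" using pN(1) power_increasing[of 1 p "2::nat"] by simp
        show "((2::nat) ^ p) ^ N \<le> 2 ^ (p * N)" by (simp add: power_mult)
        show "16 * real n * (2 * real \<tau>) ^ (2 * (p * N)) \<le> real (card E)"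
          using pN(5) dense by linarith
        show "16 * (5 * (real (2 ^ p))\<^sup>2) ^ Suc (card F) * real (2 ^ p) ^ (2 * \<tau> + 1)
            * (real (p * N) * sqrt (real (p * N))) < (real N)\<^sup>2"
          using pN(4) unfolding h_def by (rule branching_condition[OF pN(1,2)])
      qed fact+
      then obtain \<rho> \<kappa> where mono: "strict_mono_on {..<\<tau>} \<rho>" "strict_mono_on {..<\<tau>} \<kappa>"
        and range: "\<rho> ` {..<\<tau>} \<subseteq> {..<n}" "\<kappa> ` {..<\<tau>} \<subseteq> {..<n}"
        and ones: "\<forall>(i, j) \<in> F. (\<rho> i, \<kappa> j) \<in> E"
        by (elim exE conjE) (rule that)
      have sub: "{..<dim_row P} \<subseteq> {..<\<tau>}" "{..<dim_col P} \<subseteq> {..<\<tau>}" by (auto simp: \<tau>_def)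
      have "contains_copy M P"
      proof (rule contains_copyI)
        show "strict_mono_on {..<dim_row P} \<rho>" "strict_mono_on {..<dim_col P} \<kappa>"
          using mono sub by (auto intro: monotone_on_subset)
        show "\<rho> ` {..<dim_row P} \<subseteq> {..<dim_row M}" "\<kappa> ` {..<dim_col P} \<subseteq> {..<dim_col M}"
          using image_mono[OF sub(1), of \<rho>] image_mono[OF sub(2), of \<kappa>] range
          unfolding carrier_matD[OF M(1)] by (meson order_trans)+
        show "M $$ (\<rho> i, \<kappa> j) = 1" if "i < dim_row P" "j < dim_col P" "P $$ (i, j) = 1" for i j
          using ones that by (auto simp: F_def E_def)
      qed fact+
      with M(3) show False by contradiction
    qed
  qed
  \<comment> \<open>\<open>Ex_mat_le_iff\<close> compares natural numbers, hence the floor of the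
    real bound.\<close>
  then have "real (Ex_mat n P) \<le> real n powr (1 + C / log 2 (log 2 (real n)))" if "3 \<le> n" for n
    using that Ex_mat_le_iff[of n P "nat \<lfloor>real n powr (1 + C / log 2 (log 2 (real n)))\<rfloor>"]
    by (auto simp: le_nat_floor le_nat_iff le_floor_iff)
  moreover have "0 < C" by (simp add: C_def h_def)
  ultimately show ?thesis by blast
qed

end
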